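(* Let $Y$ be a Banach space with a Schauder basis $\{y_n\}$. If $X$ is an infinite-dimensional subspace of $Y$, then there is a subspace $Z$ of $X$ with a Schauder basis $\{z_n\}$ such that $E(Z,(z_n)) \leq_B E(Y,(y_n))$. Furthermore, if $X$ is a subspace of $Y$ with a normalized subsymmetric basic sequence $\{x_n\}$ in $X$, then $E(X,(x_n)) \leq_B E(Y,(y_n))$.
   Context: Banach spaces are over $\mathbb{R}$; a subspace of a Banach space means a closed linear subspace; $\mathbb{N}=\{0,1,2,\ldots\}$. A basic sequence $\{x_n\}$ in a Banach space $X$ is a sequence (indexed by $\mathbb{N}$) that is a Schauder basis of its closed linear span; it is normalized if $\|x_n\|=1$ for all $n$, and unconditional if every convergent series $\sum a_nx_n$ converges unconditionally. For a basic sequence $\{x_n\}$ in $X$, $\mathrm{coef}(X,(x_n))$ is the set of all $a=(a_n)\in\mathbb{R}^{\mathbb{N}}$ such that $\sum_n a_nx_n$ converges in $X$, and $E(X,(x_n))$ is the (Borel) equivalence relation on $\mathbb{R}^{\mathbb{N}}$ given by $(x,y)\in E(X,(x_n)) \iff x-y\in \mathrm{coef}(X,(x_n))$. A basic sequence $\{x_n\}$ is subsequence equivalent if $\mathrm{coef}(X,(x_n))=\mathrm{coef}(X,(x_{k_n}))$ for every subsequence $\{x_{k_n}\}$ of $\{x_n\}$; it is subsymmetric if it is unconditional and subsequence equivalent. For equivalence relations $E,F$ on Polish spaces $P,Q$, $E\leq_B F$ means that there is a Borel function $\theta:P\to Q$ with $xEy\iff\theta(x)F\theta(y)$ for all $x,y\in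 P$. *)

theory Defs
  imports "HOL-Analysis.Analysis"
begin

text \<open>
  The ambient Banach space is a type of class \<open>banach\<close>; its subspaces are sets.
\<close>

definition closed_subspace :: "'a::real_normed_vector set \<Rightarrow> bool" where
  "closed_subspace X \<longleftrightarrow> subspace X \<and> closed X"

definition infinite_dimensional :: "'a::real_vector set \<Rightarrow> bool" where
  "infinite_dimensional X \<longleftrightarrow> \<not> (\<exists>B. finite B \<and> X \<subseteq> span B)"

definition schauder_basis :: "'a::real_normed_vector set \<Rightarrow> (nat \<Rightarrow> 'a) \<Rightarrow> bool" where
  "schauder_basis X x \<longleftrightarrow>
     (\<forall>n. x n \<in> X) \<and> (\<forall>v\<in>X. \<exists>!a :: nat \<Rightarrow> real. (\<lambda>n. a n *\<^sub>R x n) sums v)"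

definition basic_sequence :: "'a::real_normed_vector set \<Rightarrow> (nat \<Rightarrow> 'a) \<Rightarrow> bool" where
  "basic_sequence X x \<longleftrightarrow>
     (\<forall>n. x n \<in> X) \<and> schauder_basis (closure (span (range x))) x"

definition normalized :: "(nat \<Rightarrow> 'a::real_normed_vector) \<Rightarrow> bool" where
  "normalized x \<longleftrightarrow> (\<forall>n. norm (x n) = 1)"

definition unconditionally_convergent :: "(nat \<Rightarrow> 'a::real_normed_vector) \<Rightarrow> bool" where
  "unconditionally_convergent f \<longleftrightarrow> (\<forall>p :: nat \<Rightarrow> nat. bij p \<longrightarrow> summable (\<lambda>n. f (p n)))"

definition coef :: "'a::real_normed_vector set \<Rightarrow> (nat \<Rightarrow> 'a) \<Rightarrow> (nat \<Rightarrow> real) set" where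
  "coef X x = {a. \<exists>v\<in>X. (\<lambda>n. a n *\<^sub>R x n) sums v}"

definition coef_rel ::
  "'a::real_normed_vector set \<Rightarrow> (nat \<Rightarrow> 'a) \<Rightarrow> ((nat \<Rightarrow> real) \<times> (nat \<Rightarrow> real)) set" where
  "coef_rel X x = {(a, b). (\<lambda>n. a n - b n) \<in> coef X x}"

definition unconditional :: "'a::real_normed_vector set \<Rightarrow> (nat \<Rightarrow> 'a) \<Rightarrow> bool" where
  "unconditional X x \<longleftrightarrow>
     (\<forall>a\<in>coef X x. unconditionally_convergent (\<lambda>n. a n *\<^sub>R x n))"

definition subsequence_equivalent :: "'a::real_normed_vector set \<Rightarrow> (nat \<Rightarrow> 'a) \<Rightarrow> bool" where
  "subsequence_equivalent X x \<longleftrightarrow>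
     (\<forall>k :: nat \<Rightarrow> nat. strict_mono k \<longrightarrow> coef X x = coef X (x \<circ> k))"

definition subsymmetric :: "'a::real_normed_vector set \<Rightarrow> (nat \<Rightarrow> 'a) \<Rightarrow> bool" where
  "subsymmetric X x \<longleftrightarrow>
     basic_sequence X x \<and> unconditional X x \<and> subsequence_equivalent X x"

text \<open>
  On \<open>nat \<Rightarrow> real\<close> the Borel sets are those of the product topology.
\<close>

definition borel_reducible ::
  "('p::polish_space \<times> 'p) set \<Rightarrow> ('q::polish_space \<times> 'q) set \<Rightarrow> bool"
  (infix "\<le>\<^sub>B" 50) where
  "E \<le>\<^sub>B F \<longleftrightarrow>
     (\<exists>\<theta>\<in>borel \<rightarrow>\<^sub>M borel. \<forall>x y. (x, y) \<in> E \<longleftrightarrow> (\<theta> x, \<theta> y) \<in> F)"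

end

theory Submission
  imports Defs "HOL-Complex_Analysis.Great_Picard"
begin

text \<open>
  Both halves reduce to one observation about block sequences. If consecutive finite blocks of
  the coordinates with respect to \<open>y\<close> are fixed and \<open>u n\<close> is a linear combination of the \<open>y i\<close>
  with \<open>i\<close> in the \<open>n\<close>-th block, with coefficients \<open>b i\<close>, then \<open>\<Sum> a n u n\<close> converges exactly if
  \<open>\<Sum> a (block i) b i y i\<close> does. The map that sends \<open>a\<close> to these coefficients is linear and
  continuous for the product topology, so it is a Borel reduction
  (\<open>coef_rel_reducible_via_blocks\<close>). It therefore suffices to find a sequence of the required
  kind with the same convergent series as some block sequence of \<open>y\<close>. Such sequences come from a
  gliding hump: if the differences \<open>z n - u n\<close> have summable norms and the \<open>z n\<close> stay away
  from 0, then the coefficients of a convergent series of either sequence tend to 0, so the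
  other series converges too (\<open>summable_perturbation_iff\<close>).

  The gliding hump needs continuous coordinate functionals, and passing from blocks back to
  single terms needs uniformly bounded partial-sum projections. Both follow from
  \<open>schauder_basis_constant\<close>, which is Banach's theorem that the norm \<open>sup n. norm (P n v)\<close> is
  equivalent to the original one; the proof is the Baire argument of the open mapping theorem.

  For an infinite-dimensional subspace \<open>X\<close>, one picks a unit vector \<open>z n\<close> of \<open>X\<close> whose
  coordinates vanish up to the end of the preceding block, and cuts its tail off to get \<open>u n\<close>.
  The set of sums of series in the \<open>u n\<close> is described by linear relations between coordinates,
  hence closed, and when the tails are small enough compared with the coefficient functionals
  this passes on to the \<open>z n\<close> (\<open>small_perturbation\<close>). So the sums of series in the \<open>z n\<close> form
  the subspace \<open>Z\<close>.

  A normalized subsymmetric sequence \<open>x\<close> need not be weakly null, so the gliding hump is applied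
  to differences. By compactness the coordinates converge along a subsequence; then
  the differences of its neighbouring terms have coordinates tending to 0, and a subsequence of
  these differences is a small perturbation of a block sequence. Finally \<open>\<Sum> a n x n\<close>
  and the series of differences converge for the same \<open>a\<close>: one direction is subsequence
  equivalence, and in the other unconditionality makes it possible to drop the subtracted terms
  (\<open>subsymmetric_coef_differences\<close>).
\<close>

section \<open>Uniform boundedness of the partial-sum projections\<close>

text \<open>
  The Baire category half of Banach's theorem. The vectors whose partial sums are bounded by
  \<open>k\<close> exhaust \<open>W\<close> as \<open>k\<close> grows, so for some \<open>k\<close> they are dense in a ball of \<open>W\<close>. As they form a
  symmetric convex set, they are dense in a ball around 0, and scaling gives the claim.
\<close>

lemma approximation_by_bounded_expansions:
  fixes x :: "nat \<Rightarrow> 'a::banach"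
  assumes W: "closed_subspace W" and x: "schauder_basis W x"
  shows "\<exists>C\<ge>0. \<forall>v\<in>W. \<forall>e>0. \<exists>a v'. v' \<in> W \<and> (\<lambda>i. a i *\<^sub>R x i) sums v' \<and> norm (v - v') < e \<and>
           (\<forall>n. norm (\<Sum>i<n. a i *\<^sub>R x i) \<le> C * norm v)"
proof -
  have sub: "subspace W" and cl: "closed W"
    using W by (auto simp: closed_subspace_def)
  define A where "A k = {v \<in> W. \<exists>a. (\<lambda>i. a i *\<^sub>R x i) sums v \<and>
    (\<forall>n. norm (\<Sum>i<n. a i *\<^sub>R x i) \<le> real k)}" for k
  have AW: "A k \<subseteq> W" for k by (auto simp: A_def)
  then have clAW: "closure (A k) \<subseteq> W" for k
    by (simp add: cl closure_minimal)
  have cover: "W \<subseteq> (\<Union>k. A k)"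
  proof
    fix v assume v: "v \<in> W"
    then obtain a where a: "(\<lambda>i. a i *\<^sub>R x i) sums v"
      using x unfolding schauder_basis_def by blast
    then have "Bseq (\<lambda>n. \<Sum>i<n. a i *\<^sub>R x i)"
      unfolding sums_def by (meson convergentI convergent_imp_Bseq)
    then obtain K where K: "\<And>n. norm (\<Sum>i<n. a i *\<^sub>R x i) \<le> K"
      by (meson BseqE)
    obtain k where "K \<le> real k" using real_arch_simple by blast
    then have "v \<in> A k"
      using a v K order_trans unfolding A_def by blast
    then show "v \<in> (\<Union>k. A k)" by blast
  qed
  let ?T = "top_of_set W"
  have "\<exists>k. ?T interior_of closure (A k) \<noteq> {}"
  proof (rule ccontr)
    assume no: "\<nexists>k. ?T interior_of closure (A k) \<noteq> {}"
    have "completely_metrizable_space ?T"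
      using cl closed_closedin completely_metrizable_space_closedin completely_metrizable_space_euclidean by blast
    then have "?T interior_of \<Union>(range (\<lambda>k. closure (A k))) = {}"
      using no clAW by (intro Baire_category_alt) (auto intro!: closed_subset)
    moreover have "\<Union>(range (\<lambda>k. closure (A k))) = W"
    proof
      show "W \<subseteq> \<Union>(range (\<lambda>k. closure (A k)))"
        using cover closure_subset by blast
    qed (use clAW in blast)
    ultimately show False
      using subspace_0[OF sub] interior_of_topspace[of ?T] by auto
  qed
  then obtain k w where w: "w \<in> ?T interior_of closure (A k)" by blast
  then have "w \<in> W"
    using interior_of_subset[of ?T "closure (A k)"] clAW[of k] by (metis subsetD)
  have "openin ?T (?T interior_of closure (A k))" by simp
  then obtain r where r: "r > 0" "ball w r \<inter> W \<subseteq> closure (A k)"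
    by (metis (no_types, lifting) interior_of_subset openin_contains_ball order_trans w)
  have half: "(1/2) *\<^sub>R (p - q) \<in> A k" if p: "p \<in> A k" and q: "q \<in> A k" for p q
  proof -
    obtain a where a: "(\<lambda>i. a i *\<^sub>R x i) sums p" "\<And>n. norm (\<Sum>i<n. a i *\<^sub>R x i) \<le> real k"
      using p unfolding A_def by blast
    obtain b where b: "(\<lambda>i. b i *\<^sub>R x i) sums q" "\<And>n. norm (\<Sum>i<n. b i *\<^sub>R x i) \<le> real k"
      using q unfolding A_def by blast
    have eq: "((a i - b i) / 2) *\<^sub>R x i = (1/2) *\<^sub>R (a i *\<^sub>R x i - b i *\<^sub>R x i)" for i
      by (simp add: diff_divide_distrib scaleR_diff_left scaleR_diff_right)
    have "(\<lambda>i. ((a i - b i) / 2) *\<^sub>R x i) sums ((1/2) *\<^sub>R (p - q))"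
      unfolding eq by (intro sums_scaleR_right sums_diff a b)
    moreover have "norm (\<Sum>i<n. ((a i - b i) / 2) *\<^sub>R x i) \<le> real k" for n
    proof -
      have "(\<Sum>i<n. ((a i - b i) / 2) *\<^sub>R x i) = (1/2) *\<^sub>R ((\<Sum>i<n. a i *\<^sub>R x i) - (\<Sum>i<n. b i *\<^sub>R x i))"
        unfolding eq by (simp only: sum_subtractf scaleR_right.sum[symmetric])
      also have "norm \<dots> \<le> (norm (\<Sum>i<n. a i *\<^sub>R x i) + norm (\<Sum>i<n. b i *\<^sub>R x i)) / 2"
        using norm_triangle_ineq4 by simp
      also have "\<dots> \<le> (real k + real k) / 2"
        using a(2) b(2) by (intro divide_right_mono add_mono) auto
      finally show ?thesis by simp
    qed
    moreover have "(1/2) *\<^sub>R (p - q) \<in> W"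
      using p q AW sub by (meson subsetD subspace_diff subspace_scale)
    ultimately show ?thesis
      unfolding A_def by (intro CollectI conjI exI[of _ "\<lambda>i. (a i - b i) / 2"] allI)
  qed
  have near0: "\<exists>u\<in>A k. norm (v - u) < e" if v: "v \<in> W" "norm v < r" and e: "e > 0" for v e
  proof -
    have "w + v \<in> closure (A k)" "w - v \<in> closure (A k)"
      using v \<open>w \<in> W\<close> sub
      by (auto intro!: subsetD[OF r(2)] simp: dist_norm subspace_add subspace_diff)
    then obtain p q where pq: "p \<in> A k" "dist p (w + v) < e" "q \<in> A k" "dist q (w - v) < e"
      using e by (meson closure_approachable)
    have "v - (1/2) *\<^sub>R (p - q) = (1/2) *\<^sub>R (((w + v) - p) - ((w - v) - q))"
      by (simp add: algebra_simps flip: scaleR_add_left)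
    also have "norm \<dots> = norm (((w + v) - p) - ((w - v) - q)) / 2" by simp
    also have "\<dots> \<le> (norm ((w + v) - p) + norm ((w - v) - q)) / 2"
      by (rule divide_right_mono[OF norm_triangle_ineq4]) simp
    also have "\<dots> < e" using pq by (simp add: dist_norm norm_minus_commute)
    finally show ?thesis using half[OF pq(1,3)] by blast
  qed
  let ?C = "2 * real k / r"
  \<comment> \<open>Scaling v by t moves it into the ball of radius r; this costs the factor 1/t in the bound.\<close>
  have "\<exists>a v'. v' \<in> W \<and> (\<lambda>i. a i *\<^sub>R x i) sums v' \<and> norm (v - v') < e \<and>
           (\<forall>n. norm (\<Sum>i<n. a i *\<^sub>R x i) \<le> ?C * norm v)" if v: "v \<in> W" and e: "e > 0" for v e
  proof (cases "v = 0")
    case True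
    then show ?thesis
      using v e by (intro exI[of _ "\<lambda>_. 0"] exI[of _ 0]) auto
  next
    case False
    define t where "t = r / (2 * norm v)"
    have t: "t > 0" using False r by (simp add: t_def)
    have "norm (t *\<^sub>R v) < r" "t *\<^sub>R v \<in> W"
      using False r v sub by (auto simp: t_def subspace_scale)
    then obtain u where u: "u \<in> A k" "norm (t *\<^sub>R v - u) < e * t"
      using near0 e t by (metis mult_pos_pos)
    obtain a where a: "(\<lambda>i. a i *\<^sub>R x i) sums u" "\<And>n. norm (\<Sum>i<n. a i *\<^sub>R x i) \<le> real k"
      using u unfolding A_def by blast
    have "(1/t) *\<^sub>R u \<in> W" using u AW sub by (meson subsetD subspace_scale)
    moreover have "(\<lambda>i. (a i / t) *\<^sub>R x i) sums ((1/t) *\<^sub>R u)"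
      using sums_scaleR_right[OF a(1), of "1/t"] by simp
    moreover have "norm (v - (1/t) *\<^sub>R u) < e"
    proof -
      have "v - (1/t) *\<^sub>R u = (1/t) *\<^sub>R (t *\<^sub>R v - u)"
        using t by (simp add: algebra_simps)
      then show ?thesis using u(2) t by (simp add: divide_simps mult.commute)
    qed
    moreover have "norm (\<Sum>i<n. (a i / t) *\<^sub>R x i) \<le> ?C * norm v" for n
    proof -
      have "(\<Sum>i<n. (a i / t) *\<^sub>R x i) = (1/t) *\<^sub>R (\<Sum>i<n. a i *\<^sub>R x i)"
        by (simp add: scaleR_right.sum)
      also have "norm \<dots> \<le> real k / t"
        using a(2)[of n] t by (simp add: divide_right_mono)
      also have "real k / t = ?C * norm v" by (simp add: t_def)
      finally show ?thesis .
    qed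
    ultimately show ?thesis
      by (intro exI[of _ "\<lambda>i. a i / t"] exI[of _ "(1/t) *\<^sub>R u"] conjI allI)
  qed
  moreover have "?C \<ge> 0" using r by simp
  ultimately show ?thesis by blast
qed

lemma schauder_basis_unique:
  assumes "schauder_basis W x" "v \<in> W" "(\<lambda>n. a n *\<^sub>R x n) sums v" "(\<lambda>n. b n *\<^sub>R x n) sums v"
  shows "a = b"
proof -
  have "\<exists>!a. (\<lambda>n. a n *\<^sub>R x n) sums v"
    using assms(1,2) unfolding schauder_basis_def by blast
  then show ?thesis
    using assms(3,4) by auto
qed

lemma schauder_basis_nonzero:
  assumes "schauder_basis W x" "subspace W"
  shows "x n \<noteq> 0"
proof
  assume 0: "x n = 0"
  define a b :: "nat \<Rightarrow> real" where "a = (\<lambda>i. 0)" and "b = (\<lambda>i. if i = n then 1 else 0)"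
  have "(\<lambda>i. a i *\<^sub>R x i) = (\<lambda>i. 0)" "(\<lambda>i. b i *\<^sub>R x i) = (\<lambda>i. 0)"
    using 0 by (auto simp: a_def b_def)
  then have "a = b"
    using subspace_0[OF assms(2)] by (intro schauder_basis_unique[OF assms(1)]) auto
  from fun_cong[OF this, of n] show False by (simp add: a_def b_def)
qed

text \<open>
  Successive approximation upgrades density to equality. The remainders \<open>R j\<close> shrink
  geometrically, so the approximants \<open>R j - R (j + 1)\<close> add up to \<open>v\<close>, while the sum over \<open>j\<close>
  of their \<open>n\<close>-th partial sums is bounded by a multiple of \<open>norm v\<close> and is itself the \<open>n\<close>-th
  partial sum of a series with coefficients \<open>g\<close>. Dominated convergence in \<open>j\<close> shows that this
  series converges to \<open>v\<close>, so uniqueness of the expansion identifies \<open>g\<close> with \<open>a\<close>.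
\<close>

theorem schauder_basis_constant:
  fixes x :: "nat \<Rightarrow> 'a::banach"
  assumes W: "closed_subspace W" and x: "schauder_basis W x"
  obtains K where "K > 0" "\<And>a v n. v \<in> W \<Longrightarrow> (\<lambda>i. a i *\<^sub>R x i) sums v \<Longrightarrow>
    norm (\<Sum>i<n. a i *\<^sub>R x i) \<le> K * norm v"
proof -
  have sub: "subspace W" and cl: "closed W"
    using W by (auto simp: closed_subspace_def)
  obtain C where C: "C \<ge> 0" and approx: "\<And>v e. v \<in> W \<Longrightarrow> e > 0 \<Longrightarrow>
     \<exists>a v'. v' \<in> W \<and> (\<lambda>i. a i *\<^sub>R x i) sums v' \<and> norm (v - v') < e \<and>
           (\<forall>n. norm (\<Sum>i<n. a i *\<^sub>R x i) \<le> C * norm v)"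
    using approximation_by_bounded_expansions[OF assms] by blast
  have bound: "norm (\<Sum>i<n. a i *\<^sub>R x i) \<le> 2 * C * norm v"
    if v: "v \<in> W" and av: "(\<lambda>i. a i *\<^sub>R x i) sums v" for a v n
  proof (cases "v = 0")
    case True
    then have "a = (\<lambda>i. 0)"
      using v av by (intro schauder_basis_unique[OF x v]) auto
    then show ?thesis using C by simp
  next
    case False
    define M where "M j = norm v * (1/2)^j" for j :: nat
    have M: "M j > 0" for j using False by (simp add: M_def)
    have sumM: "M sums (2 * norm v)"
      using sums_mult[OF geometric_sums[of "1/2::real"], of "norm v"] by (simp add: M_def[abs_def] mult.commute)
    define P where "P j R \<longleftrightarrow> R \<in> W \<and> norm R \<le> M j \<and> (j = 0 \<longrightarrow> R = v)" for j :: nat and R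
    define Q where "Q R R' \<longleftrightarrow> (\<exists>b. (\<lambda>i. b i *\<^sub>R x i) sums (R - R') \<and>
       (\<forall>n. norm (\<Sum>i<n. b i *\<^sub>R x i) \<le> C * norm R))" for R R'
    have "\<exists>R. \<forall>j. P j (R j) \<and> Q (R j) (R (Suc j))"
    proof (rule dependent_nat_choice)
      show "\<exists>R. P 0 R" using v by (auto simp: P_def M_def)
      fix R j assume R: "P j R"
      obtain b v' where b: "v' \<in> W" "(\<lambda>i. b i *\<^sub>R x i) sums v'" "norm (R - v') < M (Suc j)"
        "\<And>n. norm (\<Sum>i<n. b i *\<^sub>R x i) \<le> C * norm R"
        using approx[of R "M (Suc j)"] R M by (auto simp: P_def)
      then show "\<exists>R'. P (Suc j) R' \<and> Q R R'"
        using R sub by (intro exI[of _ "R - v'"]) (auto simp: P_def Q_def subspace_diff)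
    qed
    then obtain R where RP: "\<And>j. P j (R j)" and RQ: "\<And>j. Q (R j) (R (Suc j))"
      by blast
    have R0: "R 0 = v" using RP[of 0] by (simp add: P_def)
    obtain b where b: "\<And>j. (\<lambda>i. b j i *\<^sub>R x i) sums (R j - R (Suc j))"
      "\<And>j n. norm (\<Sum>i<n. b j i *\<^sub>R x i) \<le> C * norm (R j)"
      using RQ unfolding Q_def by metis
    define S where "S j n = (\<Sum>i<n. b j i *\<^sub>R x i)" for j n
    have S_le: "norm (S j n) \<le> C * M j" for j n
      using b(2)[where j=j and n=n] RP[of j] C unfolding S_def P_def by (meson mult_left_mono order_trans)
    have S_lim: "(\<lambda>n. S j n) \<longlonglongrightarrow> R j - R (Suc j)" for j
      using b(1) by (simp add: S_def sums_def)
    have v_le: "norm (R j - R (Suc j)) \<le> C * M j" for j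
      using S_le by (intro LIMSEQ_le_const2[OF tendsto_norm[OF S_lim]]) auto
    have sumCM: "summable (\<lambda>j. C * M j)" using sumM by (simp add: sums_iff summable_mult)
    have "R \<longlonglongrightarrow> 0"
    proof (rule Lim_null_comparison)
      show "\<forall>\<^sub>F j in sequentially. norm (R j) \<le> M j" using RP by (simp add: P_def)
      show "M \<longlonglongrightarrow> 0" using sumM summable_LIMSEQ_zero by (auto simp: sums_iff)
    qed
    then have v_sum: "(\<lambda>j. R j - R (Suc j)) sums v"
      using telescope_sums'[of R 0] R0 by simp
    have sumS: "summable (\<lambda>j. S j n)" for n
      by (rule summable_comparison_test'[OF sumCM]) (use S_le in auto)
    define T where "T n = (\<Sum>j. S j n)" for n
    have T_le: "norm (T n) \<le> 2 * C * norm v" for n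
    proof -
      have "norm (T n) \<le> (\<Sum>j. C * M j)"
        unfolding T_def by (rule norm_suminf_le[OF S_le sumCM])
      also have "\<dots> = 2 * C * norm v"
        using sums_mult[OF sumM, of C] by (simp add: sums_iff)
      finally show ?thesis .
    qed
    have T_lim: "T \<longlonglongrightarrow> v"
    proof -
      \<comment> \<open>Dominated convergence for the real series of the norms suffices.\<close>
      have "((\<lambda>n. \<Sum>j. norm (S j n - (R j - R (Suc j)))) \<longlongrightarrow> (\<Sum>j. 0)) sequentially"
      proof (rule conjunct2[OF conjunct2[OF tannerys_theorem[where M = "\<lambda>j. 2 * (C * M j)"]]])
        show "(\<lambda>n. norm (S j n - (R j - R (Suc j)))) \<longlonglongrightarrow> 0" for j
          using S_lim[of j] tendsto_norm_zero LIM_zero by blast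
        have "norm (norm (S j n - (R j - R (Suc j)))) \<le> 2 * (C * M j)" for j n
          using norm_triangle_ineq4[of "S j n" "R j - R (Suc j)"] S_le[of j n] v_le[of j] by simp
        then show "\<forall>\<^sub>F (j, n) in sequentially \<times>\<^sub>F sequentially.
            norm (norm (S j n - (R j - R (Suc j)))) \<le> 2 * (C * M j)"
          by (simp add: case_prod_unfold)
        show "summable (\<lambda>j. 2 * (C * M j))" using sumCM by (rule summable_mult)
      qed simp
      moreover have "norm (T n - v) \<le> (\<Sum>j. norm (S j n - (R j - R (Suc j))))" for n
      proof -
        have "summable (\<lambda>j. norm (S j n - (R j - R (Suc j))))"
        proof (rule summable_comparison_test'[OF summable_mult[OF sumCM, of 2]])
          show "norm (norm (S j n - (R j - R (Suc j)))) \<le> 2 * (C * M j)" for j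
            using norm_triangle_ineq4[of "S j n" "R j - R (Suc j)"] S_le[of j n] v_le[of j] by simp
        qed
        then have "norm (\<Sum>j. S j n - (R j - R (Suc j))) \<le> (\<Sum>j. norm (S j n - (R j - R (Suc j))))"
          by (rule summable_norm)
        moreover have "(\<Sum>j. S j n - (R j - R (Suc j))) = T n - v"
          using sums_diff[OF summable_sums[OF sumS[of n]] v_sum] by (simp add: T_def sums_iff)
        ultimately show ?thesis by simp
      qed
      ultimately have "(\<lambda>n. T n - v) \<longlonglongrightarrow> 0"
        by (intro Lim_null_comparison[of "\<lambda>n. T n - v"]) auto
      then show ?thesis by (rule LIM_zero_cancel)
    qed
    have S_step: "b j i *\<^sub>R x i = S j (Suc i) - S j i" for j i
      by (simp add: S_def)
    have sumb: "summable (\<lambda>j. b j i)" for i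
    proof (rule summable_comparison_test'[OF summable_mult[OF sumCM, of "2 / norm (x i)"]])
      fix j
      have "norm (b j i *\<^sub>R x i) \<le> 2 * (C * M j)"
        unfolding S_step using norm_triangle_ineq4[of "S j (Suc i)" "S j i"] S_le[of j i] S_le[of j "Suc i"]
        by linarith
      then show "norm (b j i) \<le> 2 / norm (x i) * (C * M j)"
        using schauder_basis_nonzero[OF x sub, of i] by (simp add: field_simps)
    qed
    define g where "g i = (\<Sum>j. b j i)" for i
    have Tg: "T n = (\<Sum>i<n. g i *\<^sub>R x i)" for n
    proof -
      have "(\<lambda>j. \<Sum>i<n. b j i *\<^sub>R x i) sums (\<Sum>i<n. g i *\<^sub>R x i)"
        unfolding g_def using sumb by (intro sums_sum sums_scaleR_left summable_sums)
      then show ?thesis by (simp add: T_def S_def sums_iff)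
    qed
    have "(\<lambda>i. g i *\<^sub>R x i) sums v" using T_lim by (simp add: sums_def flip: Tg)
    then have "g = a" using av by (intro schauder_basis_unique[OF x v])
    then show ?thesis using T_le[of n] by (simp add: Tg)
  qed
  show ?thesis
  proof (rule that[of "2 * C + 1"])
    fix a v n assume "v \<in> W" "(\<lambda>i. a i *\<^sub>R x i) sums v"
    from bound[OF this, of n] show "norm (\<Sum>i<n. a i *\<^sub>R x i) \<le> (2 * C + 1) * norm v"
      by (smt (verit) mult_right_mono norm_ge_zero)
  qed (use C in simp)
qed

section \<open>Perturbations of sequences\<close>

text \<open>
  Convergence of \<open>\<Sum> a n z n\<close> forces \<open>a n\<close> to become at most 1 in modulus, since the \<open>z n\<close>
  stay away from 0. Hence the series of the \<open>a n (z n - u n)\<close> converges absolutely.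
\<close>

lemma summable_perturbation_imp:
  fixes z u :: "nat \<Rightarrow> 'a::banach"
  assumes close: "summable (\<lambda>n. norm (z n - u n))" and d: "d > 0"
    and big: "\<forall>\<^sub>F n in sequentially. d \<le> norm (z n)"
    and conv: "summable (\<lambda>n. a n *\<^sub>R z n)"
  shows "summable (\<lambda>n. a n *\<^sub>R u n)"
proof -
  have "(\<lambda>n. norm (a n *\<^sub>R z n)) \<longlonglongrightarrow> 0"
    using summable_LIMSEQ_zero[OF conv] by (rule tendsto_norm_zero)
  then have "\<forall>\<^sub>F n in sequentially. norm (a n *\<^sub>R z n) < d"
    using d by (rule order_tendstoD)
  then have "\<forall>\<^sub>F n in sequentially. norm (a n *\<^sub>R (z n - u n)) \<le> norm (z n - u n)"
    using big
  proof eventually_elim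
    case (elim n)
    have "\<bar>a n\<bar> * d < 1 * d"
      using elim mult_left_mono[OF elim(2), of "\<bar>a n\<bar>"] by simp
    then have "\<bar>a n\<bar> \<le> 1" using d by (simp only: mult_less_cancel_right) simp
    then show ?case by (simp add: mult_left_le_one_le)
  qed
  then have "summable (\<lambda>n. a n *\<^sub>R (z n - u n))"
    using close by (rule summable_comparison_test_ev)
  from summable_diff[OF conv this] show ?thesis by (simp add: scaleR_diff_right)
qed

lemma summable_perturbation_iff:
  fixes z u :: "nat \<Rightarrow> 'a::banach"
  assumes close: "summable (\<lambda>n. norm (z n - u n))" and d: "d > 0"
    and big: "\<And>n. d \<le> norm (z n)"
  shows "summable (\<lambda>n. a n *\<^sub>R z n) \<longleftrightarrow> summable (\<lambda>n. a n *\<^sub>R u n)"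
proof
  assume "summable (\<lambda>n. a n *\<^sub>R z n)"
  then show "summable (\<lambda>n. a n *\<^sub>R u n)"
    using big by (intro summable_perturbation_imp[OF close d]) auto
next
  assume u: "summable (\<lambda>n. a n *\<^sub>R u n)"
  have "\<forall>\<^sub>F n in sequentially. norm (z n - u n) < d / 2"
    using d by (intro order_tendstoD(2)[OF summable_LIMSEQ_zero[OF close]]) simp
  then have "\<forall>\<^sub>F n in sequentially. d / 2 \<le> norm (u n)"
  proof eventually_elim
    case (elim n)
    then show ?case using big[of n] norm_triangle_sub[of "z n" "u n"] by linarith
  qed
  moreover have "summable (\<lambda>n. norm (u n - z n))"
    using close by (simp add: norm_minus_commute)
  ultimately show "summable (\<lambda>n. a n *\<^sub>R z n)"
    using d u by (intro summable_perturbation_imp[of u z "d / 2"]) auto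
qed

lemma sums_mem_closed_subspace:
  assumes "closed_subspace X" "\<And>n. f n \<in> X" "f sums v"
  shows "v \<in> X"
proof -
  have "\<And>n. (\<Sum>i<n. f i) \<in> X"
    using assms(1,2) by (auto simp: closed_subspace_def intro: subspace_sum)
  then show ?thesis
    using assms unfolding closed_subspace_def sums_def by (metis closed_sequentially)
qed

lemma coef_eq_summable:
  assumes "closed_subspace X" "\<And>n. x n \<in> X"
  shows "coef X x = {a. summable (\<lambda>n. a n *\<^sub>R x n)}"
proof -
  have "v \<in> X" if "(\<lambda>n. a n *\<^sub>R x n) sums v" for a v
    using that assms by (intro sums_mem_closed_subspace[OF assms(1) _ that])
      (auto simp: closed_subspace_def subspace_scale)
  then show ?thesis by (auto simp: coef_def summable_def)
qed

text \<open>
  The stability principle for basic sequences, in a form that produces the closed span together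
  with its basis. The weights \<open>\<eta>\<close> are reciprocals of bounds for the coefficient functionals of \<open>u\<close>.
  They make the errors so small that series with the same coefficients in \<open>z\<close> and \<open>u\<close> have sums
  \<open>w\<close> and \<open>v\<close> with \<open>norm (w - v) \<le> norm v / 2\<close>. Thus \<open>v \<longmapsto> w\<close> is bounded from below, which
  gives uniqueness of the coefficients and carries closedness over from \<open>u\<close> to \<open>z\<close>.
\<close>

lemma small_perturbation:
  fixes z u :: "nat \<Rightarrow> 'a::banach"
  assumes coeff: "\<forall>a v. (\<lambda>n. a n *\<^sub>R u n) sums v \<longrightarrow> (\<forall>n. \<bar>a n\<bar> * \<eta> n \<le> norm v)"
    and \<eta>: "\<And>n. 0 < \<eta> n" "\<And>n. \<eta> n \<le> 1"
    and close: "\<And>n. norm (z n - u n) \<le> (1/2)^(n+2) * \<eta> n"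
    and big: "\<delta> > 0" "\<And>n. \<delta> \<le> norm (z n)"
    and closed: "closed {v. \<exists>a. (\<lambda>n. a n *\<^sub>R u n) sums v}"
  shows small_perturbation_summable: "\<And>a. summable (\<lambda>n. a n *\<^sub>R z n) \<longleftrightarrow> summable (\<lambda>n. a n *\<^sub>R u n)"
    and small_perturbation_basis: "schauder_basis {w. \<exists>a. (\<lambda>n. a n *\<^sub>R z n) sums w} z"
    and small_perturbation_closed: "closed_subspace {w. \<exists>a. (\<lambda>n. a n *\<^sub>R z n) sums w}"
proof -
  let ?Z = "{w. \<exists>a. (\<lambda>n. a n *\<^sub>R z n) sums w}"
  have half: "(\<lambda>n. (1/2::real)^(n+2)) sums (1/2)"
    using sums_mult[OF geometric_sums[of "1/2::real"], of "1/4"] by (simp add: power_add)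
  have "summable (\<lambda>n. norm (z n - u n))"
  proof (rule summable_comparison_test'[OF sums_summable[OF half]])
    show "norm (norm (z n - u n)) \<le> (1/2)^(n+2)" for n
      using order_trans[OF close[of n] mult_left_mono[OF \<eta>(2)[of n], of "(1/2)^(n+2)"]]
      by (simp del: power_Suc power_add add_2_eq_Suc')
  qed
  then show iff: "summable (\<lambda>n. a n *\<^sub>R z n) \<longleftrightarrow> summable (\<lambda>n. a n *\<^sub>R u n)" for a
    using big by (rule summable_perturbation_iff)
  have dist: "norm (w - v) \<le> norm v / 2"
    if w: "(\<lambda>n. a n *\<^sub>R z n) sums w" and v: "(\<lambda>n. a n *\<^sub>R u n) sums v" for a v w
  proof -
    have le: "norm (a n *\<^sub>R z n - a n *\<^sub>R u n) \<le> (1/2)^(n+2) * norm v" for n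
    proof -
      have "norm (a n *\<^sub>R z n - a n *\<^sub>R u n) = \<bar>a n\<bar> * norm (z n - u n)"
        by (simp flip: scaleR_diff_right)
      also have "\<dots> \<le> \<bar>a n\<bar> * ((1/2)^(n+2) * \<eta> n)"
        by (rule mult_left_mono[OF close]) simp
      also have "\<dots> = (1/2)^(n+2) * (\<bar>a n\<bar> * \<eta> n)" by (simp only: mult_ac)
      also have "\<dots> \<le> (1/2)^(n+2) * norm v"
        using coeff v by (intro mult_left_mono) auto
      finally show ?thesis .
    qed
    have "w - v = (\<Sum>n. a n *\<^sub>R z n - a n *\<^sub>R u n)"
      using sums_diff[OF w v] by (simp add: sums_iff)
    also have "norm \<dots> \<le> (\<Sum>n. (1/2)^(n+2) * norm v)"
      using le by (rule norm_suminf_le) (rule summable_mult2[OF sums_summable[OF half]])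
    also have "\<dots> = norm v / 2"
      using sums_mult2[OF half, of "norm v"] by (simp add: sums_iff)
    finally show ?thesis .
  qed
  have control: "norm v \<le> 2 * norm w"
    if w: "(\<lambda>n. a n *\<^sub>R z n) sums w" and v: "(\<lambda>n. a n *\<^sub>R u n) sums v" for a v w
    using dist[OF w v] norm_triangle_sub[of v w] by (simp add: norm_minus_commute)
  have diff: "(\<lambda>n. (a n - b n) *\<^sub>R x n) sums (v - w)"
    if "(\<lambda>n. a n *\<^sub>R x n) sums v" "(\<lambda>n. b n *\<^sub>R x n) sums w" for a b v w and x :: "nat \<Rightarrow> 'a"
    using sums_diff[OF that] by (simp add: scaleR_diff_left)
  have unique: "a = b" if a: "(\<lambda>n. a n *\<^sub>R z n) sums w" and b: "(\<lambda>n. b n *\<^sub>R z n) sums w" for a b w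
  proof
    fix n
    have 0: "(\<lambda>n. (a n - b n) *\<^sub>R z n) sums 0" using diff[OF a b] by simp
    then obtain v where v: "(\<lambda>n. (a n - b n) *\<^sub>R u n) sums v"
      using iff[of "\<lambda>n. a n - b n"] unfolding summable_def by blast
    have "norm v \<le> 0" using control[OF 0 v] by simp
    then have "\<bar>a n - b n\<bar> * \<eta> n \<le> 0" using coeff v by (meson order_trans)
    then show "a n = b n" using \<eta>(1)[of n] by (simp add: mult_le_0_iff)
  qed
  have "z n \<in> ?Z" for n
  proof -
    have "(\<lambda>i. (if i = n then 1 else 0) *\<^sub>R z i) = (\<lambda>i. if i = n then z i else 0)" by auto
    then have "(\<lambda>i. (if i = n then 1 else 0) *\<^sub>R z i) sums z n"
      using sums_single[of n z] by simp
    then show ?thesis by (intro CollectI exI)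
  qed
  with unique show "schauder_basis ?Z z"
    unfolding schauder_basis_def by blast
  have "subspace ?Z"
  proof (rule subspaceI)
    show "0 \<in> ?Z" by (auto intro!: exI[of _ "\<lambda>_. 0"])
  next
    fix v w assume "v \<in> ?Z" "w \<in> ?Z"
    then obtain a b where "(\<lambda>n. a n *\<^sub>R z n) sums v" "(\<lambda>n. b n *\<^sub>R z n) sums w" by blast
    from sums_add[OF this] have "(\<lambda>n. (a n + b n) *\<^sub>R z n) sums (v + w)"
      by (simp add: scaleR_add_left)
    then show "v + w \<in> ?Z" by (intro CollectI exI)
  next
    fix r v assume "v \<in> ?Z"
    then obtain a where "(\<lambda>n. a n *\<^sub>R z n) sums v" by blast
    from sums_scaleR_right[OF this, of r] have "(\<lambda>n. (r * a n) *\<^sub>R z n) sums (r *\<^sub>R v)" by simp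
    then show "r *\<^sub>R v \<in> ?Z" by (intro CollectI exI)
  qed
  moreover have "closed ?Z"
    unfolding closed_sequential_limits
  proof (intro allI impI, elim conjE)
    fix w l assume "\<forall>k. w k \<in> ?Z" and lim: "w \<longlonglongrightarrow> l"
    then obtain a where a: "\<And>k. (\<lambda>n. a k n *\<^sub>R z n) sums w k" by auto metis
    then have "\<exists>v. (\<lambda>n. a k n *\<^sub>R u n) sums v" for k
      using iff[of "a k"] by (auto simp: summable_def)
    then obtain v where v: "\<And>k. (\<lambda>n. a k n *\<^sub>R u n) sums v k" by metis
    have "Cauchy v"
    proof (rule CauchyI)
      fix e :: real assume "e > 0"
      then obtain M where M: "\<And>k l. k \<ge> M \<Longrightarrow> l \<ge> M \<Longrightarrow> norm (w k - w l) < e / 2"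
        using CauchyD[OF LIMSEQ_imp_Cauchy[OF lim], of "e / 2"] by auto
      have "norm (v k - v l) < e" if "k \<ge> M" "l \<ge> M" for k l
        using control[OF diff[OF a a] diff[OF v v], of k l] M[OF that] by linarith
      then show "\<exists>M. \<forall>k\<ge>M. \<forall>l\<ge>M. norm (v k - v l) < e" by blast
    qed
    then obtain v' where v': "v \<longlonglongrightarrow> v'" using Cauchy_convergent_iff convergent_def by blast
    then have "v' \<in> {v. \<exists>a. (\<lambda>n. a n *\<^sub>R u n) sums v}"
      using closed v unfolding closed_sequential_limits by blast
    then obtain b where b: "(\<lambda>n. b n *\<^sub>R u n) sums v'" by blast
    then obtain w' where w': "(\<lambda>n. b n *\<^sub>R z n) sums w'"
      using iff[of b] unfolding summable_def by blast
    have "(\<lambda>k. w k - w') \<longlonglongrightarrow> 0"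
    proof (rule Lim_null_comparison)
      have "norm (w k - w') \<le> 2 * norm (v k - v')" for k
        using dist[OF diff[OF a w'] diff[OF v b], of k] norm_triangle_sub[of "w k - w'" "v k - v'"]
          norm_ge_zero[of "v k - v'"] by linarith
      then show "\<forall>\<^sub>F k in sequentially. norm (w k - w') \<le> 2 * norm (v k - v')" by simp
      show "(\<lambda>k. 2 * norm (v k - v')) \<longlonglongrightarrow> 0"
        using v' by (intro tendsto_mult_right_zero tendsto_norm_zero LIM_zero)
    qed
    then have "w \<longlonglongrightarrow> w'" by (rule LIM_zero_cancel)
    then have "w' = l" using lim by (rule LIMSEQ_unique)
    then show "l \<in> ?Z" using w' by blast
  qed
  ultimately show "closed_subspace ?Z" by (simp add: closed_subspace_def)
qed

section \<open>Series grouped into blocks\<close>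

text \<open>
  The index of the block containing \<open>i\<close>, where the \<open>n\<close>-th block is \<open>{m n..<m (Suc n)}\<close>.
  The value is meaningful only for \<open>i \<ge> m 0\<close>.
\<close>

definition block :: "(nat \<Rightarrow> nat) \<Rightarrow> nat \<Rightarrow> nat" where
  "block m i = (GREATEST n. m n \<le> i)"

lemma block_unique:
  assumes "strict_mono m" "m n \<le> i" "i < m (Suc n)"
  shows "block m i = n"
  unfolding block_def
proof (rule Greatest_equality)
  fix k assume "m k \<le> i"
  then have "m k < m (Suc n)" using assms by simp
  then show "k \<le> n" using assms(1) by (simp add: strict_mono_less)
qed (use assms in simp)

lemma block_bounds:
  assumes m: "strict_mono m" and i: "m n \<le> i"
  shows "n \<le> block m i" "m (block m i) \<le> i" "i < m (Suc (block m i))"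
proof -
  have bd: "k \<le> i" if "m k \<le> i" for k
    using that strict_mono_imp_increasing[OF m, of k] by simp
  show "m (block m i) \<le> i" "n \<le> block m i"
    unfolding block_def using i bd
    by (auto intro: GreatestI_nat[where P="\<lambda>n. m n \<le> i"] Greatest_le_nat[where P="\<lambda>n. m n \<le> i"])
  show "i < m (Suc (block m i))"
  proof (rule ccontr)
    assume "\<not> ?thesis"
    then have "Suc (block m i) \<le> block m i"
      unfolding block_def using bd by (intro Greatest_le_nat[where P="\<lambda>n. m n \<le> i"]) auto
    then show False by simp
  qed
qed

lemma sum_blocks:
  fixes f :: "nat \<Rightarrow> 'a::ab_group_add"
  assumes m: "strict_mono m"
  shows "(\<Sum>k<n. \<Sum>i\<in>{m k..<m (Suc k)}. f i) = (\<Sum>i<m n. f i) - (\<Sum>i<m 0. f i)"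
proof (induction n)
  case (Suc n)
  have "m n \<le> m (Suc n)" using m by (simp add: strict_mono_less_eq)
  then have "(\<Sum>i<m (Suc n). f i) = (\<Sum>i<m n. f i) + (\<Sum>i\<in>{m n..<m (Suc n)}. f i)"
    unfolding lessThan_atLeast0 by (simp add: sum.atLeastLessThan_concat)
  with Suc show ?case by simp
qed simp

lemma summable_blocks:
  fixes f :: "nat \<Rightarrow> 'a::real_normed_vector"
  assumes m: "strict_mono m" and f: "summable f"
  shows "summable (\<lambda>n. \<Sum>i\<in>{m n..<m (Suc n)}. f i)"
proof -
  have "(\<lambda>n. \<Sum>i<m n. f i) \<longlonglongrightarrow> suminf f"
    using LIMSEQ_subseq_LIMSEQ[OF summable_LIMSEQ[OF f] m] by (simp add: o_def)
  then have "(\<lambda>n. (\<Sum>i<m n. f i) - (\<Sum>i<m 0. f i)) \<longlonglongrightarrow> suminf f - (\<Sum>i<m 0. f i)"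
    by (intro tendsto_diff) auto
  then show ?thesis
    unfolding summable_def sums_def sum_blocks[OF m] by blast
qed

text \<open>
  Convergence of the grouped series controls the partial sums only at the ends of blocks. A
  partial sum that ends inside the \<open>n\<close>-th block differs from that by an initial segment of the
  block, which the null sequence \<open>g\<close> bounds.
\<close>

lemma summable_from_blocks:
  fixes f :: "nat \<Rightarrow> 'a::real_normed_vector"
  assumes m: "strict_mono m"
    and conv: "summable (\<lambda>n. \<Sum>i\<in>{m n..<m (Suc n)}. f i)"
    and g: "g \<longlonglongrightarrow> 0"
    and inner: "\<And>n l. m n \<le> l \<Longrightarrow> l \<le> m (Suc n) \<Longrightarrow> norm (\<Sum>i\<in>{m n..<l}. f i) \<le> g n"
  shows "summable f"
proof -
  define L where "L = (\<Sum>n. \<Sum>i\<in>{m n..<m (Suc n)}. f i) + (\<Sum>i<m 0. f i)"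
  have "(\<lambda>n. (\<Sum>i<m n. f i) - (\<Sum>i<m 0. f i)) \<longlonglongrightarrow> L - (\<Sum>i<m 0. f i)"
    using summable_LIMSEQ[OF conv] by (simp add: sum_blocks[OF m] L_def)
  from tendsto_add[OF this tendsto_const[of "\<Sum>i<m 0. f i"]]
  have lim: "(\<lambda>n. (\<Sum>i<m n. f i) - L) \<longlonglongrightarrow> 0"
    by (simp add: LIM_zero)
  have "(\<lambda>l. \<Sum>i<l. f i) \<longlonglongrightarrow> L"
  proof (rule LIMSEQ_I)
    fix e :: real assume e: "e > 0"
    have "\<forall>\<^sub>F n in sequentially. norm ((\<Sum>i<m n. f i) - L) < e / 2"
      using e by (intro order_tendstoD(2)[OF tendsto_norm_zero[OF lim]]) simp
    moreover have "\<forall>\<^sub>F n in sequentially. g n < e / 2"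
      using e by (intro order_tendstoD(2)[OF g]) simp
    ultimately have "\<forall>\<^sub>F n in sequentially. norm ((\<Sum>i<m n. f i) - L) < e / 2 \<and> g n < e / 2"
      by (rule eventually_conj)
    then obtain N where N: "\<And>n. n \<ge> N \<Longrightarrow> norm ((\<Sum>i<m n. f i) - L) < e / 2 \<and> g n < e / 2"
      unfolding eventually_sequentially by blast
    have "norm ((\<Sum>i<l. f i) - L) < e" if l: "l \<ge> m N" for l
    proof -
      define n where "n = block m l"
      note n = block_bounds[OF m l, folded n_def]
      have "(\<Sum>i<l. f i) - L = ((\<Sum>i<m n. f i) - L) + (\<Sum>i\<in>{m n..<l}. f i)"
        using n(2) unfolding lessThan_atLeast0 by (simp add: sum.atLeastLessThan_concat[of 0 "m n" l f, symmetric])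
      also have "norm \<dots> < e / 2 + e / 2"
        using N[OF n(1)] inner[of n l] n by (intro norm_add_less) auto
      finally show ?thesis by simp
    qed
    then show "\<exists>N. \<forall>l\<ge>N. norm ((\<Sum>i<l. f i) - L) < e" by blast
  qed
  then show ?thesis unfolding summable_def sums_def by blast
qed

section \<open>Coordinates and block sequences with respect to a basis\<close>

text \<open>
  The reducing map: the coefficients with respect to \<open>y\<close> of \<open>\<Sum> a n u n\<close> when \<open>u n\<close> is the
  combination of the \<open>y i\<close> with coefficients \<open>b i\<close> over the \<open>n\<close>-th block.
\<close>

definition spread :: "(nat \<Rightarrow> nat) \<Rightarrow> (nat \<Rightarrow> real) \<Rightarrow> (nat \<Rightarrow> real) \<Rightarrow> nat \<Rightarrow> real" where
  "spread m b a i = (if i < m 0 then 0 else a (block m i) * b i)"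

lemma spread_diff: "spread m b (\<lambda>n. a n - a' n) i = spread m b a i - spread m b a' i"
  by (simp add: spread_def algebra_simps)

lemma continuous_spread: "continuous_on UNIV (spread m b)"
proof (rule continuous_on_coordinatewise_then_product)
  fix i
  show "continuous_on UNIV (\<lambda>a. spread m b a i)"
    unfolding spread_def
    by (cases "i < m 0") (auto intro!: continuous_intros continuous_on_product_coordinates)
qed

locale banach_basis =
  fixes y :: "nat \<Rightarrow> 'a::banach"
  assumes basis: "schauder_basis UNIV y"
begin

definition coord :: "'a \<Rightarrow> nat \<Rightarrow> real" where
  "coord v = (THE a. (\<lambda>i. a i *\<^sub>R y i) sums v)"

lemma coord_sums: "(\<lambda>i. coord v i *\<^sub>R y i) sums v"
proof -
  have "\<exists>!a. (\<lambda>i. a i *\<^sub>R y i) sums v"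
    using basis unfolding schauder_basis_def by blast
  then show ?thesis unfolding coord_def by (rule theI')
qed

lemma coord_eqI: "(\<lambda>i. a i *\<^sub>R y i) sums v \<Longrightarrow> coord v = a"
  by (rule schauder_basis_unique[OF basis UNIV_I coord_sums])

lemma coord_add: "coord (v + w) i = coord v i + coord w i"
proof -
  have "coord (v + w) = (\<lambda>i. coord v i + coord w i)"
    using sums_add[OF coord_sums coord_sums] by (intro coord_eqI) (simp add: scaleR_add_left)
  then show ?thesis by simp
qed

lemma coord_scaleR: "coord (r *\<^sub>R v) i = r * coord v i"
proof -
  have "coord (r *\<^sub>R v) = (\<lambda>i. r * coord v i)"
    using sums_scaleR_right[OF coord_sums, of r] by (intro coord_eqI) simp
  then show ?thesis by simp
qed

lemma coord_combination:
  assumes "finite F"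
  shows "coord (\<Sum>i\<in>F. b i *\<^sub>R y i) = (\<lambda>i. if i \<in> F then b i else 0)"
proof (rule coord_eqI)
  have "(\<lambda>i. if i \<in> F then b i *\<^sub>R y i else 0) = (\<lambda>i. (if i \<in> F then b i else 0) *\<^sub>R y i)"
    by auto
  then show "(\<lambda>i. (if i \<in> F then b i else 0) *\<^sub>R y i) sums (\<Sum>i\<in>F. b i *\<^sub>R y i)"
    using sums_If_finite_set[OF assms, of "\<lambda>i. b i *\<^sub>R y i"] by simp
qed

definition trunc :: "nat \<Rightarrow> 'a \<Rightarrow> 'a" where
  "trunc n v = (\<Sum>i<n. coord v i *\<^sub>R y i)"

lemma trunc_tendsto: "(\<lambda>n. trunc n v) \<longlonglongrightarrow> v"
  using coord_sums by (simp add: trunc_def sums_def)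

lemma trunc_bound: obtains K where "K > 0" "\<And>n v. norm (trunc n v) \<le> K * norm v"
proof -
  have "closed_subspace (UNIV :: 'a set)" by (simp add: closed_subspace_def)
  from schauder_basis_constant[OF this basis] that show ?thesis
    unfolding trunc_def by (metis UNIV_I coord_sums)
qed

lemma y_nonzero: "y i \<noteq> 0"
  by (rule schauder_basis_nonzero[OF basis]) simp

lemma coord_bound: obtains K where "K > 0" "\<And>i v. \<bar>coord v i\<bar> * norm (y i) \<le> K * norm v"
proof -
  obtain K where K: "K > 0" "\<And>n v. norm (trunc n v) \<le> K * norm v" using trunc_bound by blast
  have "\<bar>coord v i\<bar> * norm (y i) \<le> (2 * K) * norm v" for i v
  proof -
    have "coord v i *\<^sub>R y i = trunc (Suc i) v - trunc i v" by (simp add: trunc_def)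
    then have "\<bar>coord v i\<bar> * norm (y i) \<le> norm (trunc (Suc i) v) + norm (trunc i v)"
      by (metis norm_scaleR norm_triangle_ineq4)
    then show ?thesis using K(2)[of "Suc i" v] K(2)[of i v] by linarith
  qed
  with K(1) show ?thesis by (intro that[of "2 * K"]) auto
qed

lemma bounded_linear_coord: "bounded_linear (\<lambda>v. coord v i)"
proof -
  obtain K where K: "K > 0" "\<And>i v. \<bar>coord v i\<bar> * norm (y i) \<le> K * norm v"
    using coord_bound by blast
  show ?thesis
  proof (rule bounded_linear_intro)
    show "norm (coord v i) \<le> norm v * (K / norm (y i))" for v
      using K(2)[of v i] y_nonzero[of i] by (simp add: field_simps)
  qed (simp_all add: coord_add coord_scaleR)
qed

text \<open>
  Grouping the spread series into blocks gives the series of the \<open>a n u n\<close>. An initial segment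
  of the \<open>n\<close>-th block is a truncation of \<open>a n u n\<close>, so its norm is at most the basis constant
  times the norm of a term of a convergent series.
\<close>

lemma summable_spread_iff:
  assumes m: "strict_mono m" and u: "\<And>n. u n = (\<Sum>i\<in>{m n..<m (Suc n)}. b i *\<^sub>R y i)"
  shows "summable (\<lambda>i. spread m b a i *\<^sub>R y i) \<longleftrightarrow> summable (\<lambda>n. a n *\<^sub>R u n)"
proof -
  let ?f = "\<lambda>i. spread m b a i *\<^sub>R y i"
  have spread: "spread m b a i = a n * b i" if "m n \<le> i" "i < m (Suc n)" for i n
    using that block_unique[OF m that] m strict_mono_less_eq[of m 0 n] unfolding spread_def by auto
  have part: "(\<Sum>i\<in>{m n..<l}. ?f i) = a n *\<^sub>R (\<Sum>i\<in>{m n..<l}. b i *\<^sub>R y i)"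
    if "l \<le> m (Suc n)" for n l
    unfolding scaleR_right.sum using that by (intro sum.cong) (auto simp: spread)
  then have whole: "(\<Sum>i\<in>{m n..<m (Suc n)}. ?f i) = a n *\<^sub>R u n" for n
    by (simp add: u)
  show ?thesis
  proof
    assume "summable ?f"
    from summable_blocks[OF m this] show "summable (\<lambda>n. a n *\<^sub>R u n)" by (simp add: whole)
  next
    assume au: "summable (\<lambda>n. a n *\<^sub>R u n)"
    obtain K where K: "K > 0" "\<And>n v. norm (trunc n v) \<le> K * norm v" using trunc_bound by blast
    have lim: "(\<lambda>n. K * norm (a n *\<^sub>R u n)) \<longlonglongrightarrow> 0"
      using summable_LIMSEQ_zero[OF au] by (intro tendsto_mult_right_zero tendsto_norm_zero)
    show "summable ?f"
    proof (rule summable_from_blocks[OF m _ lim])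
      show "summable (\<lambda>n. \<Sum>i\<in>{m n..<m (Suc n)}. ?f i)" using au by (simp add: whole)
      fix n l assume l: "m n \<le> l" "l \<le> m (Suc n)"
      have "trunc l (u n) = (\<Sum>i<l. if i \<in> {m n..<m (Suc n)} then b i *\<^sub>R y i else 0)"
        unfolding trunc_def u coord_combination[OF finite_atLeastLessThan] by (intro sum.cong) auto
      also have "\<dots> = (\<Sum>i\<in>{m n..<l}. b i *\<^sub>R y i)"
        using l by (subst sum.inter_restrict[symmetric]) (auto intro!: sum.cong)
      finally have "(\<Sum>i\<in>{m n..<l}. ?f i) = a n *\<^sub>R trunc l (u n)"
        using part[OF l(2)] by simp
      then show "norm (\<Sum>i\<in>{m n..<l}. ?f i) \<le> K * norm (a n *\<^sub>R u n)"
        using mult_left_mono[OF K(2)[of l "u n"], of "\<bar>a n\<bar>"] by (simp add: mult_ac)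
    qed
  qed
qed

lemma coef_UNIV: "coef UNIV y = {a. summable (\<lambda>i. a i *\<^sub>R y i)}"
  by (auto simp: coef_def summable_def)

text \<open>
  Since \<open>spread m b\<close> is linear, the relation between \<open>spread m b a\<close> and \<open>spread m b a'\<close> depends
  on the spread of the difference alone, and \<open>summable_spread_iff\<close> applies to that.
\<close>

theorem coef_rel_reducible_via_blocks:
  assumes m: "strict_mono m" and u: "\<And>n. u n = (\<Sum>i\<in>{m n..<m (Suc n)}. b i *\<^sub>R y i)"
    and coef: "\<And>a. a \<in> coef Z z \<longleftrightarrow> summable (\<lambda>n. a n *\<^sub>R u n)"
  shows "coef_rel Z z \<le>\<^sub>B coef_rel UNIV y"
  unfolding borel_reducible_def
proof (intro bexI allI)
  show "spread m b \<in> borel \<rightarrow>\<^sub>M borel"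
    by (rule borel_measurable_continuous_onI[OF continuous_spread])
  show "(a, a') \<in> coef_rel Z z \<longleftrightarrow> (spread m b a, spread m b a') \<in> coef_rel UNIV y" for a a'
    using summable_spread_iff[OF m u, of "\<lambda>n. a n - a' n"]
    by (simp add: coef_rel_def coef_UNIV coef spread_diff)
qed

lemma coord_eq_imp_eq: "coord v = coord w \<Longrightarrow> v = w"
  by (metis coord_sums sums_unique2)

lemma coord_block_sum:
  assumes m: "strict_mono m" and u: "\<And>n. u n = (\<Sum>i\<in>{m n..<m (Suc n)}. b i *\<^sub>R y i)"
    and v: "(\<lambda>n. a n *\<^sub>R u n) sums v"
  shows "coord v = spread m b a"
proof
  fix i
  have "(\<lambda>n. coord (a n *\<^sub>R u n) i) sums coord v i"
    by (rule bounded_linear.sums[OF bounded_linear_coord v])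
  then have s: "(\<lambda>n. a n * (if i \<in> {m n..<m (Suc n)} then b i else 0)) sums coord v i"
    by (simp add: coord_scaleR u coord_combination[OF finite_atLeastLessThan] cong: if_cong)
  show "coord v i = spread m b a i"
  proof (cases "i < m 0")
    case True
    then have "i < m n" for n using m by (metis le0 less_le_trans strict_mono_less_eq)
    then have "(\<lambda>n. a n * (if i \<in> {m n..<m (Suc n)} then b i else 0)) = (\<lambda>n. 0)"
      by (auto simp: not_le[symmetric])
    then show ?thesis using s True by (simp add: spread_def sums_unique2)
  next
    case False
    have "i \<in> {m n..<m (Suc n)} \<longleftrightarrow> n = block m i" for n
      using block_bounds[OF m, of 0 i] block_unique[OF m, of n i] False by auto
    then have "(\<lambda>n. a n * (if i \<in> {m n..<m (Suc n)} then b i else 0)) =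
      (\<lambda>n. if n = block m i then a n * b i else 0)" by auto
    then have "coord v i = a (block m i) * b i"
      using s sums_single[of "block m i" "\<lambda>n. a n * b i"] by (simp add: sums_unique2)
    then show ?thesis using False by (simp add: spread_def)
  qed
qed

text \<open>
  Membership in the span of the blocks is a system of linear equations between coordinates: on
  each block the coordinates are proportional to \<open>b\<close>. The nonzero entry at \<open>j n\<close> serves to read
  off the factor of proportionality, and continuity of the coordinates makes the relations
  survive limits.
\<close>

lemma closed_block_span:
  assumes m: "strict_mono m" and u: "\<And>n. u n = (\<Sum>i\<in>{m n..<m (Suc n)}. b i *\<^sub>R y i)"
    and j: "\<And>n. j n \<in> {m n..<m (Suc n)}" "\<And>n. b (j n) \<noteq> 0"
  shows "closed {v. \<exists>a. (\<lambda>n. a n *\<^sub>R u n) sums v}"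
  unfolding closed_sequential_limits
proof (intro allI impI, elim conjE)
  fix v l assume vU: "\<forall>k. v k \<in> {v. \<exists>a. (\<lambda>n. a n *\<^sub>R u n) sums v}" and lim: "v \<longlonglongrightarrow> l"
  have clim: "(\<lambda>k. coord (v k) i) \<longlonglongrightarrow> coord l i" for i
    by (rule bounded_linear.tendsto[OF bounded_linear_coord lim])
  from vU obtain a where a: "\<And>k. (\<lambda>n. a k n *\<^sub>R u n) sums v k" by auto metis
  have vk: "coord (v k) = spread m b (a k)" for k
    by (rule coord_block_sum[OF m u a])
  define c where "c n = coord l (j n) / b (j n)" for n
  have "coord l i = spread m b c i" for i
  proof (cases "i < m 0")
    case True
    then have "coord (v k) i = 0" for k by (simp add: vk spread_def)
    then show ?thesis using clim[of i] True by (simp add: spread_def LIMSEQ_const_iff)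
  next
    case False
    let ?j = "j (block m i)"
    have jb: "block m ?j = block m i" "\<not> ?j < m 0"
      using j(1)[of "block m i"] block_unique[OF m, of "block m i" ?j] strict_mono_less_eq[OF m, of 0 "block m i"]
      by auto
    have "coord (v k) i = coord (v k) ?j / b ?j * b i" for k
      using False jb j(2)[of "block m i"] by (simp add: vk spread_def)
    then have "(\<lambda>k. coord (v k) ?j / b ?j * b i) \<longlonglongrightarrow> coord l i" using clim[of i] by simp
    moreover have "(\<lambda>k. coord (v k) ?j / b ?j * b i) \<longlonglongrightarrow> coord l ?j / b ?j * b i"
      by (intro tendsto_mult tendsto_divide clim tendsto_const j(2))
    ultimately have "coord l i = coord l ?j / b ?j * b i" by (rule LIMSEQ_unique)
    then show ?thesis using False by (simp add: spread_def c_def)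
  qed
  then have eq: "coord l = spread m b c" by auto
  then have "summable (\<lambda>n. c n *\<^sub>R u n)"
    using coord_sums[of l] summable_spread_iff[OF m u, of c] by (simp add: summable_def) blast
  then obtain l' where l': "(\<lambda>n. c n *\<^sub>R u n) sums l'" unfolding summable_def by blast
  have "l' = l" using coord_block_sum[OF m u l'] eq by (intro coord_eq_imp_eq) simp
  then show "l \<in> {v. \<exists>a. (\<lambda>n. a n *\<^sub>R u n) sums v}" using l' by blast
qed

end

section \<open>A reducible basic sequence in every infinite-dimensional subspace\<close>

lemma infinite_dimensional_kernel:
  fixes f :: "'a::real_vector \<Rightarrow> real"
  assumes X: "subspace X" "infinite_dimensional X" and f: "linear f"
  shows "infinite_dimensional (X \<inter> {v. f v = 0})"
  unfolding infinite_dimensional_def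
proof
  assume "\<exists>B. finite B \<and> X \<inter> {v. f v = 0} \<subseteq> span B"
  then obtain B where B: "finite B" "X \<inter> {v. f v = 0} \<subseteq> span B" by blast
  obtain w where w: "w \<in> X" "f w \<noteq> 0"
    using B X(2) unfolding infinite_dimensional_def by blast
  have "v \<in> span (insert w B)" if v: "v \<in> X" for v
  proof -
    define r where "r = f v / f w"
    have "f (v - r *\<^sub>R w) = 0"
      using w by (simp add: r_def linear_diff[OF f] linear_scale[OF f])
    moreover have "v - r *\<^sub>R w \<in> X" using v w X by (simp add: subspace_diff subspace_scale)
    ultimately have "v - r *\<^sub>R w \<in> span B" using B by blast
    then have "v - r *\<^sub>R w \<in> span (insert w B)" using span_mono[of B "insert w B"] by blast
    moreover have "r *\<^sub>R w \<in> span (insert w B)" by (simp add: span_base span_scale)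
    ultimately have "v - r *\<^sub>R w + r *\<^sub>R w \<in> span (insert w B)" by (rule span_add)
    then show ?thesis by simp
  qed
  then show False using B(1) X(2) unfolding infinite_dimensional_def by blast
qed

context banach_basis
begin

text \<open>
  Each condition \<open>coord v i = 0\<close> cuts out the kernel of a functional, which leaves an
  infinite-dimensional space.
\<close>

lemma exists_normalized_vanishing_coords:
  fixes X :: "'a set"
  assumes X: "subspace X" "infinite_dimensional X"
  obtains v where "v \<in> X" "norm v = 1" "\<And>i. i < n \<Longrightarrow> coord v i = 0"
proof -
  let ?X = "\<lambda>n. {v \<in> X. \<forall>i<n. coord v i = 0}"
  have lin: "linear (\<lambda>v. coord v i)" for i
    using bounded_linear_coord by (rule bounded_linear.linear)
  have "subspace (?X n) \<and> infinite_dimensional (?X n)" for n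
  proof (induction n)
    case (Suc n)
    have eq: "?X (Suc n) = ?X n \<inter> {v. coord v n = 0}" by (auto simp: less_Suc_eq)
    have "subspace (?X n \<inter> {v. coord v n = 0})"
      using Suc lin[of n] by (intro subspace_inter) (auto intro: linear_subspace_kernel)
    then show ?case
      unfolding eq using Suc infinite_dimensional_kernel[OF _ _ lin[of n]] by blast
  qed (use X in simp)
  then have sub: "subspace (?X n)" and "\<not> ?X n \<subseteq> span {}"
    unfolding infinite_dimensional_def by blast+
  then obtain v where v: "v \<in> ?X n" "v \<noteq> 0" by auto
  show ?thesis
  proof (rule that[of "(1 / norm v) *\<^sub>R v"])
    show "(1 / norm v) *\<^sub>R v \<in> X" using v X by (simp add: subspace_scale)
  qed (use v in \<open>auto simp: coord_scaleR\<close>)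
qed

text \<open>
  The gliding hump. Stage \<open>n\<close> starts from the end \<open>m n\<close> of the previous block and chooses a unit
  vector \<open>z n\<close> in \<open>X\<close> that vanishes before \<open>m n\<close>, together with an index \<open>j n\<close> of a nonzero
  coordinate. Because \<open>m (Suc n)\<close> is chosen beyond \<open>j n\<close>, truncation at \<open>m (Suc n)\<close> leaves this
  coordinate unchanged, so the coefficient functional of the truncated vectors is bounded in
  terms of \<open>z n\<close> and \<open>j n\<close> alone, before the size of the tail has to be chosen.
\<close>

theorem reducible_subspace_exists:
  fixes X :: "'a set"
  assumes X: "closed_subspace X" "infinite_dimensional X"
  shows "\<exists>Z z. closed_subspace Z \<and> Z \<subseteq> X \<and> schauder_basis Z z \<and> coef_rel Z z \<le>\<^sub>B coef_rel UNIV y"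
proof -
  have sub: "subspace X" using X by (simp add: closed_subspace_def)
  obtain K where K: "K > 0" "\<And>i v. \<bar>coord v i\<bar> * norm (y i) \<le> K * norm v"
    using coord_bound by blast
  \<comment> \<open>In a series of the truncated vectors with sum v, the n-th coefficient is the quotient of the
    j n-th coordinates of v and z n; its modulus is therefore at most norm v / H (z n) (j n).\<close>
  define H where "H v i = \<bar>coord v i\<bar> * norm (y i) / K" for v :: 'a and i
  \<comment> \<open>A state is a triple of the start of the block, the vector and the index of a nonzero coordinate.\<close>
  define P where "P n s \<longleftrightarrow> (case s of (m, v, j) \<Rightarrow> v \<in> X \<and> norm v = 1 \<and>
      (\<forall>i<m. coord v i = 0) \<and> coord v j \<noteq> 0)" for n :: nat and s :: "nat \<times> 'a \<times> nat"
  define Q where "Q n s s' \<longleftrightarrow> (case (s, s') of ((m, v, j), (m', _)) \<Rightarrow> m < m' \<and> j < m' \<and>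
      norm (v - trunc m' v) \<le> (1/2)^(n+2) * H v j)"
    for n and s s' :: "nat \<times> 'a \<times> nat"
  have start: "\<exists>v j. P n (m, v, j)" for n m
  proof -
    obtain v where v: "v \<in> X" "norm v = 1" "\<And>i. i < m \<Longrightarrow> coord v i = 0"
      using exists_normalized_vanishing_coords[OF sub X(2)] by blast
    have "\<exists>j. coord v j \<noteq> 0"
    proof (rule ccontr)
      assume "\<nexists>j. coord v j \<noteq> 0"
      then have "v = 0" using coord_sums[of v] by (simp add: sums_unique2)
      then show False using v(2) by simp
    qed
    then show ?thesis using v by (auto simp: P_def)
  qed
  have "\<exists>s. \<forall>n. P n (s n) \<and> Q n (s n) (s (Suc n))"
  proof (rule dependent_nat_choice)
    show "\<exists>s. P 0 s" using start by blast
    fix s n assume s: "P n s"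
    obtain m v j where s_eq: "s = (m, v, j)" by (cases s) auto
    have "(1/2)^(n+2) * H v j > 0" using s K y_nonzero by (simp add: P_def s_eq H_def)
    then have "\<forall>\<^sub>F m' in sequentially. dist (trunc m' v) v < (1/2)^(n+2) * H v j"
      by (rule tendstoD[OF trunc_tendsto])
    moreover have "\<forall>\<^sub>F m' in sequentially. m + j < m'" by (rule eventually_gt_at_top)
    ultimately have "\<forall>\<^sub>F m' in sequentially. dist (trunc m' v) v < (1/2)^(n+2) * H v j \<and> m + j < m'"
      by (rule eventually_conj)
    then obtain m' where m': "dist (trunc m' v) v < (1/2)^(n+2) * H v j" "m + j < m'"
      using eventually_happens'[OF sequentially_bot] by blast
    obtain v' j' where "P (Suc n) (m', v', j')" using start by blast
    moreover have "Q n s (m', v', j')"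
      using m' by (simp add: Q_def s_eq dist_norm norm_minus_commute less_imp_le)
    ultimately show "\<exists>s'. P (Suc n) s' \<and> Q n s s'" by blast
  qed
  then obtain s where s: "\<And>n. P n (s n)" "\<And>n. Q n (s n) (s (Suc n))" by blast
  define m where "m n = fst (s n)" for n
  define z where "z n = fst (snd (s n))" for n
  define j where "j n = snd (snd (s n))" for n
  have zX: "z n \<in> X" and z1: "norm (z n) = 1" and z0: "i < m n \<Longrightarrow> coord (z n) i = 0"
    and zj: "coord (z n) (j n) \<noteq> 0" for n i
    using s(1)[of n] by (auto simp: P_def m_def z_def j_def split: prod.splits)
  have mS: "m n < m (Suc n)" and jm: "j n < m (Suc n)"
    and close: "norm (z n - trunc (m (Suc n)) (z n)) \<le> (1/2)^(n+2) * H (z n) (j n)" for n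
    using s(2)[of n] by (auto simp: Q_def m_def z_def j_def split: prod.splits)
  have m: "strict_mono m" using mS by (simp add: strict_mono_Suc_iff)
  have mj: "j n \<in> {m n..<m (Suc n)}" for n
    using jm[of n] zj[of n] z0[of "j n" n] by (meson atLeastLessThan_iff not_le)
  define u where "u n = trunc (m (Suc n)) (z n)" for n
  define b where "b i = coord (z (block m i)) i" for i
  have u: "u n = (\<Sum>i\<in>{m n..<m (Suc n)}. b i *\<^sub>R y i)" for n
  proof -
    have "u n = (\<Sum>i\<in>{m n..<m (Suc n)}. coord (z n) i *\<^sub>R y i)"
      unfolding u_def trunc_def by (rule sum.mono_neutral_right) (auto simp: z0)
    also have "\<dots> = (\<Sum>i\<in>{m n..<m (Suc n)}. b i *\<^sub>R y i)"
      by (intro sum.cong) (auto simp: b_def block_unique[OF m])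
    finally show ?thesis .
  qed
  have blk: "block m (j n) = n" "\<not> j n < m 0" for n
    using mj[of n] block_unique[OF m, of n "j n"] strict_mono_less_eq[OF m, of 0 n] by auto
  have bj: "b (j n) = coord (z n) (j n)" for n
    by (simp add: b_def blk)
  define \<eta> where "\<eta> n = H (z n) (j n)" for n
  have coeff: "\<forall>a v. (\<lambda>n. a n *\<^sub>R u n) sums v \<longrightarrow> (\<forall>n. \<bar>a n\<bar> * \<eta> n \<le> norm v)"
  proof (intro allI impI)
    fix a v n assume v: "(\<lambda>n. a n *\<^sub>R u n) sums v"
    have "coord v (j n) = a n * coord (z n) (j n)"
      by (simp add: coord_block_sum[OF m u v] spread_def bj blk)
    then show "\<bar>a n\<bar> * \<eta> n \<le> norm v"
      using K(2)[of v "j n"] K(1) by (simp add: \<eta>_def H_def abs_mult field_simps)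
  qed
  have \<eta>: "0 < \<eta> n" "\<eta> n \<le> 1" for n
    using zj[of n] K y_nonzero K(2)[of "z n" "j n"] by (auto simp: \<eta>_def H_def z1)
  have closedU: "closed {v. \<exists>a. (\<lambda>n. a n *\<^sub>R u n) sums v}"
    using zj by (intro closed_block_span[where b = b and j = j, OF m u mj]) (simp add: bj)
  let ?Z = "{w. \<exists>a. (\<lambda>n. a n *\<^sub>R z n) sums w}"
  note pert = small_perturbation[where z = z and u = u and \<eta> = \<eta> and \<delta> = 1,
      OF coeff \<eta> close[folded u_def \<eta>_def] zero_less_one eq_refl[OF z1[symmetric]] closedU]
  have Z: "closed_subspace ?Z" by (rule pert)
  have zbasis: "schauder_basis ?Z z" by (rule pert)
  have "?Z \<subseteq> X"
  proof
    fix w assume "w \<in> ?Z"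
    then obtain a where "(\<lambda>n. a n *\<^sub>R z n) sums w" by blast
    then show "w \<in> X"
      by (rule sums_mem_closed_subspace[OF X(1) subspace_scale[OF sub zX]])
  qed
  moreover have "coef_rel ?Z z \<le>\<^sub>B coef_rel UNIV y"
  proof (rule coef_rel_reducible_via_blocks[OF m u])
    have "\<And>n. z n \<in> ?Z" using zbasis by (auto simp: schauder_basis_def)
    then show "a \<in> coef ?Z z \<longleftrightarrow> summable (\<lambda>n. a n *\<^sub>R u n)" for a
      using pert(1)[of a] by (subst coef_eq_summable[OF Z]) auto
  qed
  ultimately show ?thesis using Z zbasis by blast
qed

end

section \<open>Subseries of unconditionally convergent series\<close>

lemma ex_interval_permutation:
  assumes F: "F \<subseteq> {s..<t::nat}"
  shows "\<exists>p. bij_betw p {s..<t} {s..<t} \<and> p ` {s..<s + card F} = F"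
proof -
  have fin: "finite F" using F finite_subset by blast
  have card: "card F \<le> t - s" using card_mono[OF _ F] by simp
  obtain p where p: "bij_betw p {s..<s + card F} F"
    using finite_same_card_bij[of "{s..<s + card F}" F] fin by auto
  obtain q where q: "bij_betw q {s + card F..<t} ({s..<t} - F)"
    using finite_same_card_bij[of "{s + card F..<t}" "{s..<t} - F"] F fin by (auto simp: card_Diff_subset)
  let ?r = "\<lambda>i. if i \<in> {s..<s + card F} then p i else q i"
  have "bij_betw ?r ({s..<s + card F} \<union> {s + card F..<t}) (F \<union> ({s..<t} - F))"
    by (rule bij_betw_disjoint_Un[OF p q]) auto
  moreover have "{s..<s + card F} \<union> {s + card F..<t} = {s..<t}"
  proof (cases "s \<le> t")
    case False
    then have "F = {}" using F by auto
    then show ?thesis using False by auto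
  qed (use card in auto)
  moreover have "F \<union> ({s..<t} - F) = {s..<t}" using F by blast
  moreover have "?r ` {s..<s + card F} = F"
    using p by (simp add: bij_betw_def)
  ultimately show ?thesis by (intro exI[of _ ?r]) simp
qed

lemma bij_from_block_permutations:
  assumes m: "strict_mono m" and m0: "m 0 = 0"
    and q: "\<And>k. bij_betw (q k) {m k..<m (Suc k)} {m k..<m (Suc k)}"
  shows "bij (\<lambda>i. q (block m i) i)"
proof (rule bijI)
  have mem: "i \<in> {m (block m i)..<m (Suc (block m i))}" for i
    using block_bounds[OF m, of 0 i] by (simp add: m0)
  have image: "q (block m i) i \<in> {m (block m i)..<m (Suc (block m i))}" for i
    using bij_betwE[OF q] mem by blast
  then have blk: "block m (q (block m i) i) = block m i" for i
    by (intro block_unique[OF m]) auto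
  show "inj (\<lambda>i. q (block m i) i)"
  proof (rule injI)
    fix i j assume eq: "q (block m i) i = q (block m j) j"
    then have "block m i = block m j" using blk by metis
    then show "i = j" using eq mem[of i] mem[of j] q[of "block m i"]
      by (auto simp: bij_betw_def dest: inj_onD)
  qed
  show "surj (\<lambda>i. q (block m i) i)"
    unfolding surj_def
  proof
    fix j
    have "j \<in> q (block m j) ` {m (block m j)..<m (Suc (block m j))}"
      using q[of "block m j"] mem[of j] by (simp add: bij_betw_def)
    then obtain i where i: "i \<in> {m (block m j)..<m (Suc (block m j))}" "j = q (block m j) i" by blast
    then have "block m i = block m j" by (intro block_unique[OF m]) auto
    then show "\<exists>i. j = q (block m i) i" using i by metis
  qed
qed

text \<open>
  If a subseries diverges, then arbitrarily far out there are finite sets \<open>F\<close> with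
  \<open>norm (sum f F) \<ge> e\<close>. Choosing such a set inside each block of a partition of the indices and
  moving it to the front of its block yields a rearrangement whose partial sums are not Cauchy.
\<close>

theorem unconditional_imp_subseries:
  fixes f :: "nat \<Rightarrow> 'a::banach"
  assumes f: "unconditionally_convergent f"
  shows "summable (\<lambda>n. if n \<in> A then f n else 0)"
proof (rule ccontr)
  assume "\<not> ?thesis"
  then obtain e where e: "e > 0"
    and bad: "\<And>N. \<exists>s\<ge>N. \<exists>t. e \<le> norm (\<Sum>n\<in>{s..<t}. if n \<in> A then f n else 0)"
    unfolding summable_Cauchy by (meson not_less)
  have "\<exists>m. \<forall>k. (k = 0 \<longrightarrow> m k = 0) \<and>
     (m k < m (Suc k) \<and> (\<exists>F\<subseteq>{m k..<m (Suc k)}. e \<le> norm (sum f F)))"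
  proof (rule dependent_nat_choice)
    fix N k :: nat
    obtain s t where st: "s \<ge> N" "e \<le> norm (\<Sum>n\<in>{s..<t}. if n \<in> A then f n else 0)"
      using bad by blast
    then have "e \<le> norm (sum f ({s..<t} \<inter> A))" by (simp add: sum.inter_restrict)
    moreover have "{s..<t} \<inter> A \<subseteq> {N..<N + t + 1}" using st(1) by auto
    ultimately show "\<exists>M. (Suc k = 0 \<longrightarrow> M = 0) \<and> N < M \<and> (\<exists>F\<subseteq>{N..<M}. e \<le> norm (sum f F))"
      by (intro exI[of _ "N + t + 1"]) auto
  qed simp
  then obtain m where m0: "m 0 = 0" and mS: "\<And>k. m k < m (Suc k)"
    and "\<And>k. \<exists>F\<subseteq>{m k..<m (Suc k)}. e \<le> norm (sum f F)" by blast
  then obtain F where F: "\<And>k. F k \<subseteq> {m k..<m (Suc k)}" "\<And>k. e \<le> norm (sum f (F k))" by metis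
  have m: "strict_mono m" using mS by (simp add: strict_mono_Suc_iff)
  obtain q where q: "\<And>k. bij_betw (q k) {m k..<m (Suc k)} {m k..<m (Suc k)}"
    "\<And>k. q k ` {m k..<m k + card (F k)} = F k"
    using ex_interval_permutation[OF F(1)] by metis
  define p where "p i = q (block m i) i" for i
  have "bij p" unfolding p_def by (rule bij_from_block_permutations[OF m m0 q(1)])
  then have "summable (\<lambda>i. f (p i))" using f unfolding unconditionally_convergent_def by blast
  then obtain N where N: "\<And>s t. s \<ge> N \<Longrightarrow> norm (\<Sum>i\<in>{s..<t}. f (p i)) < e"
    unfolding summable_Cauchy using e by blast
  let ?I = "{m N..<m N + card (F N)}"
  have card: "card (F N) \<le> m (Suc N) - m N" using card_mono[OF _ F(1)[of N]] by simp
  then have I: "?I \<subseteq> {m N..<m (Suc N)}" using mS[of N] by auto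
  have "(\<Sum>i\<in>?I. f (p i)) = (\<Sum>i\<in>?I. f (q N i))"
    using I by (intro sum.cong) (auto simp: p_def block_unique[OF m, of N] subset_iff)
  also have "\<dots> = sum f (F N)"
    using sum.reindex[of "q N" ?I f] q I by (metis bij_betw_imp_inj_on comp_def inj_on_subset sum.cong)
  finally have "e \<le> norm (\<Sum>i\<in>?I. f (p i))" using F(2) by simp
  moreover have "N \<le> m N" using m by (rule strict_mono_imp_increasing)
  ultimately show False using N[of "m N" "m N + card (F N)"] by simp
qed

section \<open>Subsymmetric sequences\<close>

lemma subspace_closure:
  fixes S :: "'a::real_normed_vector set"
  assumes S: "subspace S"
  shows "subspace (closure S)"
proof (rule subspaceI)
  show "0 \<in> closure S" using subspace_0[OF S] closure_subset by blast
next
  fix v w assume "v \<in> closure S" "w \<in> closure S"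
  then obtain f g where "\<And>n. f n \<in> S" "f \<longlonglongrightarrow> v" "\<And>n. g n \<in> S" "g \<longlonglongrightarrow> w"
    unfolding closure_sequential by blast
  then have "\<forall>n. f n + g n \<in> S" "(\<lambda>n. f n + g n) \<longlonglongrightarrow> v + w"
    using S by (auto intro: tendsto_add subspace_add)
  then show "v + w \<in> closure S"
    unfolding closure_sequential by (intro exI[of _ "\<lambda>n. f n + g n"] conjI)
next
  fix r :: real and v assume "v \<in> closure S"
  then obtain f where "\<And>n. f n \<in> S" "f \<longlonglongrightarrow> v"
    unfolding closure_sequential by blast
  then have "\<forall>n. r *\<^sub>R f n \<in> S" "(\<lambda>n. r *\<^sub>R f n) \<longlonglongrightarrow> r *\<^sub>R v"
    using S by (auto intro: tendsto_scaleR subspace_scale)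
  then show "r *\<^sub>R v \<in> closure S"
    unfolding closure_sequential by (intro exI[of _ "\<lambda>n. r *\<^sub>R f n"] conjI)
qed

text \<open>
  For \<open>i < j\<close>, the vector \<open>x i\<close> is a partial sum of the expansion of \<open>x i - x j\<close>, so the basis
  constant of \<open>x\<close> bounds its norm.
\<close>

lemma normalized_basic_separated:
  fixes x :: "nat \<Rightarrow> 'a::banach"
  assumes x: "basic_sequence X x" "normalized x"
  obtains \<delta> where "\<delta> > 0" "\<And>i j. i \<noteq> j \<Longrightarrow> \<delta> \<le> norm (x i - x j)"
proof -
  let ?W = "closure (span (range x))"
  have W: "closed_subspace ?W"
    by (simp add: closed_subspace_def subspace_closure)
  have basis: "schauder_basis ?W x" using x by (simp add: basic_sequence_def)
  obtain K where K: "K > 0" "\<And>a v n. v \<in> ?W \<Longrightarrow> (\<lambda>i. a i *\<^sub>R x i) sums v \<Longrightarrow>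
    norm (\<Sum>i<n. a i *\<^sub>R x i) \<le> K * norm v"
    using schauder_basis_constant[OF W basis] by blast
  have less: "1 / K \<le> norm (x i - x j)" if "i < j" for i j
  proof -
    define a :: "nat \<Rightarrow> real" where "a n = (if n = i then 1 else 0) - (if n = j then 1 else 0)" for n
    have a: "a n *\<^sub>R x n = (if n = i then x n else 0) - (if n = j then x n else 0)" for n
      by (simp add: a_def)
    have "(\<lambda>n. a n *\<^sub>R x n) sums (x i - x j)"
      unfolding a by (intro sums_diff sums_single)
    moreover have "x i - x j \<in> ?W"
      by (intro subsetD[OF closure_subset] span_diff span_base rangeI)
    ultimately have "norm (\<Sum>n<j. a n *\<^sub>R x n) \<le> K * norm (x i - x j)" by (intro K)
    moreover have "(\<Sum>n<j. a n *\<^sub>R x n) = x i"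
      unfolding a sum_subtractf using that by (simp add: sum.delta)
    ultimately show ?thesis using K(1) x(2) by (simp add: normalized_def field_simps)
  qed
  show ?thesis
  proof (rule that[of "1 / K"])
    show "1 / K \<le> norm (x i - x j)" if "i \<noteq> j" for i j
      using less[of i j] less[of j i] that by (metis norm_minus_commute nat_neq_iff)
  qed (use K in simp)
qed

text \<open>
  The two halves of the difference series converge separately if \<open>a\<close> is a coefficient sequence,
  by subsequence equivalence. Conversely, convergence of the difference series forces \<open>a\<close> to
  tend to 0, so the brackets may be dropped: the alternating sequence
  \<open>a 0, - a 0, a 1, - a 1, ...\<close> is a coefficient sequence along \<open>k\<close>, hence along \<open>x\<close> itself.
  By unconditionality its even entries alone still give a convergent series, and subsequence equivalence along the
  even numbers turns these into \<open>a\<close>.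
\<close>

theorem subsymmetric_coef_differences:
  fixes x :: "nat \<Rightarrow> 'a::banach"
  assumes X: "closed_subspace X" and x: "subsymmetric X x" "normalized x" and k: "strict_mono k"
  shows "a \<in> coef X x \<longleftrightarrow> summable (\<lambda>n. a n *\<^sub>R (x (k (2 * n)) - x (k (2 * n + 1))))"
proof -
  have basic: "basic_sequence X x" using x by (simp add: subsymmetric_def)
  then have xX: "\<And>n. x n \<in> X" by (simp add: basic_sequence_def)
  have coef: "coef X (x \<circ> l) = {a. summable (\<lambda>n. a n *\<^sub>R x (l n))}" for l
    using xX by (simp add: coef_eq_summable[OF X])
  have sub: "coef X x = {a. summable (\<lambda>n. a n *\<^sub>R x (l n))}" if "strict_mono l" for l
    using x that by (simp add: subsymmetric_def subsequence_equivalent_def flip: coef)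
  have even: "strict_mono (\<lambda>n. k (2 * n))" and odd: "strict_mono (\<lambda>n. k (2 * n + 1))"
    using k by (auto simp: strict_mono_def)
  show ?thesis
  proof
    assume "a \<in> coef X x"
    then have "summable (\<lambda>n. a n *\<^sub>R x (k (2 * n)))" "summable (\<lambda>n. a n *\<^sub>R x (k (2 * n + 1)))"
      using sub[OF even] sub[OF odd] by blast+
    from summable_diff[OF this] show "summable (\<lambda>n. a n *\<^sub>R (x (k (2 * n)) - x (k (2 * n + 1))))"
      by (simp add: scaleR_diff_right)
  next
    let ?d = "\<lambda>n. x (k (2 * n)) - x (k (2 * n + 1))"
    assume ad: "summable (\<lambda>n. a n *\<^sub>R ?d n)"
    have adlim: "(\<lambda>n. norm (a n *\<^sub>R ?d n)) \<longlonglongrightarrow> 0"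
      using summable_LIMSEQ_zero[OF ad] by (rule tendsto_norm_zero)
    obtain \<delta> where \<delta>: "\<delta> > 0" "\<And>i j. i \<noteq> j \<Longrightarrow> \<delta> \<le> norm (x i - x j)"
      using normalized_basic_separated[OF basic x(2)] by blast
    have alim: "(\<lambda>n. norm (a n)) \<longlonglongrightarrow> 0"
    proof (rule Lim_null_comparison[of "\<lambda>n. norm (a n)" "\<lambda>n. norm (a n *\<^sub>R ?d n) / \<delta>"])
      have "norm (norm (a n)) \<le> norm (a n *\<^sub>R ?d n) / \<delta>" for n
      proof -
        have "k (2 * n) \<noteq> k (2 * n + 1)" using k by (simp add: strict_mono_eq)
        then have "\<bar>a n\<bar> * \<delta> \<le> norm (a n *\<^sub>R ?d n)"
          unfolding norm_scaleR by (intro mult_left_mono \<delta>(2)) auto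
        then show ?thesis using \<delta>(1) by (simp only: pos_le_divide_eq real_norm_def abs_abs)
      qed
      then show "\<forall>\<^sub>F n in sequentially. norm (norm (a n)) \<le> norm (a n *\<^sub>R ?d n) / \<delta>" by simp
      show "(\<lambda>n. norm (a n *\<^sub>R ?d n) / \<delta>) \<longlonglongrightarrow> 0" using adlim by (rule tendsto_divide_zero)
    qed
    define c where "c i = (-1)^i * a (i div 2)" for i
    have sum2: "(\<Sum>i\<in>{2*n..<2*n+2}. c i *\<^sub>R x (k i)) = a n *\<^sub>R ?d n" for n
      by (simp add: c_def atLeastLessThanSuc algebra_simps)
    have "summable (\<lambda>i. c i *\<^sub>R x (k i))"
    proof (rule summable_from_blocks[where m = "\<lambda>n. 2 * n" and g = "\<lambda>n. norm (a n) + norm (a n *\<^sub>R ?d n)"])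
      show "strict_mono (\<lambda>n. 2 * n :: nat)" by (simp add: strict_mono_def)
      show "summable (\<lambda>n. \<Sum>i\<in>{2 * n..<2 * Suc n}. c i *\<^sub>R x (k i))"
        using ad unfolding mult_Suc_right add.commute[of 2] sum2 .
      show "(\<lambda>n. norm (a n) + norm (a n *\<^sub>R ?d n)) \<longlonglongrightarrow> 0"
        using tendsto_add[OF alim adlim] by simp
      fix n l :: nat assume l: "2 * n \<le> l" "l \<le> 2 * Suc n"
      then have "l = 2 * n \<or> l = 2 * n + 1 \<or> l = 2 * n + 2" by auto
      then consider "l = 2 * n" | "l = 2 * n + 1" | "l = 2 * n + 2" by blast
      then show "norm (\<Sum>i\<in>{2 * n..<l}. c i *\<^sub>R x (k i)) \<le> norm (a n) + norm (a n *\<^sub>R ?d n)"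
      proof cases
        case 2
        then show ?thesis using x(2) by (simp add: c_def normalized_def)
      next
        case 3
        show ?thesis unfolding 3 sum2 by simp
      qed simp
    qed
    then have c: "c \<in> coef X x" using sub[OF k] by blast
    then have "unconditionally_convergent (\<lambda>i. c i *\<^sub>R x i)"
      using x by (simp add: subsymmetric_def unconditional_def)
    then have "summable (\<lambda>i. if i \<in> {i. even i} then c i *\<^sub>R x i else 0)"
      by (rule unconditional_imp_subseries)
    moreover have two: "strict_mono (\<lambda>n. 2 * n :: nat)" by (simp add: strict_mono_def)
    ultimately have "summable (\<lambda>n. if 2 * n \<in> {i. even i} then c (2 * n) *\<^sub>R x (2 * n) else 0)"
      by (subst (asm) summable_mono_reindex[OF two, symmetric]) (auto elim!: evenE)
    then show "a \<in> coef X x" using sub[OF two] by (simp add: c_def)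
  qed
qed

context banach_basis
begin

text \<open>
  A pair \<open>(p, m)\<close> of the recursive choice consists of the position of a difference \<open>d p\<close> and the
  start \<open>m\<close> of its block; \<open>d p\<close> is almost zero before \<open>m\<close>, and almost zero from the start of the
  next block on.
\<close>

theorem subsymmetric_reducible:
  fixes X :: "'a set"
  assumes X: "closed_subspace X" and x: "subsymmetric X x" "normalized x"
  shows "coef_rel X x \<le>\<^sub>B coef_rel UNIV y"
proof -
  have norm_x: "norm (x n) = 1" for n using x(2) by (simp add: normalized_def)
  obtain K where K: "K > 0" "\<And>i v. \<bar>coord v i\<bar> * norm (y i) \<le> K * norm v"
    using coord_bound by blast
  \<comment> \<open>The factor norm (y i) makes the bound for the coordinates uniform in i.\<close>
  obtain s where s: "strict_mono s" "\<And>i. \<exists>l. (\<lambda>n. coord (x (s n)) i * norm (y i)) \<longlonglongrightarrow> l"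
  proof (rule function_convergent_subsequence[of UNIV "\<lambda>n i. coord (x n) i * norm (y i)" K])
    show "norm (coord (x n) i * norm (y i)) \<le> K" for n i
      using K(2)[of "x n" i] by (simp add: norm_x abs_mult)
  qed (use that in auto)
  define d where "d n = x (s n) - x (s (Suc n))" for n
  have coord_d: "(\<lambda>n. coord (d n) i) \<longlonglongrightarrow> 0" for i
  proof -
    obtain l where l: "(\<lambda>n. coord (x (s n)) i * norm (y i)) \<longlonglongrightarrow> l" using s(2) by blast
    have "(\<lambda>n. (coord (x (s n)) i * norm (y i) - coord (x (s (Suc n))) i * norm (y i)) / norm (y i)) \<longlonglongrightarrow> (l - l) / norm (y i)"
      using y_nonzero by (intro tendsto_divide tendsto_diff l LIMSEQ_Suc[OF l] tendsto_const) auto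
    moreover have "(coord (x (s n)) i * norm (y i) - coord (x (s (Suc n))) i * norm (y i)) / norm (y i) = coord (d n) i" for n
      using y_nonzero[of i] coord_add[of "d n" "x (s (Suc n))" i] by (simp add: d_def field_simps)
    ultimately show ?thesis by simp
  qed
  have trunc_d: "(\<lambda>n. trunc N (d n)) \<longlonglongrightarrow> 0" for N
  proof -
    have "(\<lambda>n. \<Sum>i<N. coord (d n) i *\<^sub>R y i) \<longlonglongrightarrow> (\<Sum>i<N. 0 *\<^sub>R y i)"
      by (intro tendsto_sum tendsto_scaleR coord_d tendsto_const)
    then show ?thesis by (simp add: trunc_def)
  qed
  have "\<exists>t. \<forall>n. (case t n of (p, m) \<Rightarrow> norm (trunc m (d p)) < (1/2)^n) \<and>
    (case (t n, t (Suc n)) of ((p, m), (p', m')) \<Rightarrow>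
       Suc p < p' \<and> m < m' \<and> norm (d p - trunc m' (d p)) < (1/2)^n)"
  proof (rule dependent_nat_choice)
    show "\<exists>t. case t of (p, m) \<Rightarrow> norm (trunc m (d p)) < (1/2)^0"
      by (intro exI[of _ "(0, 0)"]) (simp add: trunc_def)
    fix t :: "nat \<times> nat" and n
    obtain p m where t: "t = (p, m)" by (cases t)
    have half: "(0::real) < (1/2)^n" for n by simp
    have "\<forall>\<^sub>F m' in sequentially. dist (trunc m' (d p)) (d p) < (1/2)^n \<and> m < m'"
      by (intro eventually_conj tendstoD[OF trunc_tendsto half] eventually_gt_at_top)
    then obtain m' where m': "dist (trunc m' (d p)) (d p) < (1/2)^n" "m < m'"
      using eventually_happens'[OF sequentially_bot] by blast
    have "\<forall>\<^sub>F p' in sequentially. dist (trunc m' (d p')) 0 < (1/2)^Suc n \<and> Suc p < p'"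
      by (intro eventually_conj tendstoD[OF trunc_d half] eventually_gt_at_top)
    then obtain p' where "dist (trunc m' (d p')) 0 < (1/2)^Suc n" "Suc p < p'"
      using eventually_happens'[OF sequentially_bot] by blast
    with m' show "\<exists>t'. (case t' of (p, m) \<Rightarrow> norm (trunc m (d p)) < (1/2)^Suc n) \<and>
      (case (t, t') of ((p, m), (p', m')) \<Rightarrow>
         Suc p < p' \<and> m < m' \<and> norm (d p - trunc m' (d p)) < (1/2)^n)"
      by (intro exI[of _ "(p', m')"]) (simp add: t dist_norm norm_minus_commute)
  qed
  then obtain t where t: "\<forall>n. (case t n of (p, m) \<Rightarrow> norm (trunc m (d p)) < (1/2)^n) \<and>
    (case (t n, t (Suc n)) of ((p, m), (p', m')) \<Rightarrow>
       Suc p < p' \<and> m < m' \<and> norm (d p - trunc m' (d p)) < (1/2)^n)" by (rule exE)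
  define p where "p n = fst (t n)" for n
  define m where "m n = snd (t n)" for n
  have head: "norm (trunc (m n) (d (p n))) < (1/2)^n" for n
    using spec[OF t, of n] by (simp add: p_def m_def case_prod_beta)
  have pS: "Suc (p n) < p (Suc n)" and mS: "m n < m (Suc n)"
    and tail: "norm (d (p n) - trunc (m (Suc n)) (d (p n))) < (1/2)^n" for n
    using spec[OF t, of n] by (simp_all add: p_def m_def case_prod_beta)
  have m: "strict_mono m" using mS by (simp add: strict_mono_Suc_iff)
  define u where "u n = trunc (m (Suc n)) (d (p n)) - trunc (m n) (d (p n))" for n
  define b where "b i = coord (d (p (block m i))) i" for i
  have u: "u n = (\<Sum>i\<in>{m n..<m (Suc n)}. b i *\<^sub>R y i)" for n
  proof -
    have "u n = (\<Sum>i\<in>{m n..<m (Suc n)}. coord (d (p n)) i *\<^sub>R y i)"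
      using mS[of n] unfolding u_def trunc_def lessThan_atLeast0
      by (subst sum_diff_nat_ivl) auto
    also have "\<dots> = (\<Sum>i\<in>{m n..<m (Suc n)}. b i *\<^sub>R y i)"
      by (intro sum.cong) (auto simp: b_def block_unique[OF m])
    finally show ?thesis .
  qed
  define k where "k i = (if even i then s (p (i div 2)) else s (Suc (p (i div 2))))" for i
  have "strict_mono k"
    unfolding strict_mono_Suc_iff
  proof
    fix i show "k i < k (Suc i)"
      using pS[of "i div 2"] s(1) by (cases "even i") (auto simp: k_def strict_mono_less)
  qed
  from subsymmetric_coef_differences[OF X x this]
  have coef: "a \<in> coef X x \<longleftrightarrow> summable (\<lambda>n. a n *\<^sub>R d (p n))" for a
    by (simp add: k_def d_def)
  obtain \<delta> where \<delta>: "\<delta> > 0" "\<And>i j. i \<noteq> j \<Longrightarrow> \<delta> \<le> norm (x i - x j)"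
    using normalized_basic_separated[OF _ x(2)] x(1) unfolding subsymmetric_def by blast
  have "summable (\<lambda>n. norm (d (p n) - u n))"
  proof (rule summable_comparison_test'[where g = "\<lambda>n. 2 * (1/2::real)^n"])
    show "summable (\<lambda>n. 2 * (1/2::real)^n)" by (simp add: summable_mult summable_geometric)
    show "norm (norm (d (p n) - u n)) \<le> 2 * (1/2)^n" for n
    proof -
      have split: "d (p n) - u n = (d (p n) - trunc (m (Suc n)) (d (p n))) + trunc (m n) (d (p n))"
        by (simp add: u_def)
      have "norm (d (p n) - u n) \<le> norm (d (p n) - trunc (m (Suc n)) (d (p n))) + norm (trunc (m n) (d (p n)))"
        unfolding split by (rule norm_triangle_ineq)
      also have "\<dots> \<le> 2 * (1/2)^n" using head[of n] tail[of n] by linarith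
      finally show ?thesis by simp
    qed
  qed
  moreover have "\<delta> \<le> norm (d (p n))" for n
    unfolding d_def using s(1) by (intro \<delta>(2)) (simp add: strict_mono_eq)
  ultimately have "summable (\<lambda>n. a n *\<^sub>R d (p n)) \<longleftrightarrow> summable (\<lambda>n. a n *\<^sub>R u n)" for a
    using \<delta>(1) by (intro summable_perturbation_iff)
  with coef show ?thesis by (intro coef_rel_reducible_via_blocks[OF m u]) simp
qed

end

section \<open>The reducibility theorem\<close>

theorem theorem1p1:
  fixes y :: "nat \<Rightarrow> 'a::banach"
  assumes "schauder_basis UNIV y"
  shows "(\<forall>X :: 'a set. closed_subspace X \<and> infinite_dimensional X \<longrightarrow>
            (\<exists>Z z. closed_subspace Z \<and> Z \<subseteq> X \<and> schauder_basis Z z \<and>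
                   coef_rel Z z \<le>\<^sub>B coef_rel UNIV y)) \<and>
         (\<forall>(X :: 'a set) x. closed_subspace X \<and> subsymmetric X x \<and> normalized x \<longrightarrow>
            coef_rel X x \<le>\<^sub>B coef_rel UNIV y)"
proof -
  interpret banach_basis y using assms by unfold_locales
  show ?thesis using reducible_subspace_exists subsymmetric_reducible by blast
qed

end
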